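(* Let $H$ be a complex Hilbert space with $\dim H\geq 3$. Let $\phi:\mathcal{E}(H)\to\mathcal{E}(H)$ be a bijective map such that for every $E,F\in\mathcal{E}(H)$ \[ E\leq F \Longleftrightarrow \phi(E)\leq \phi(F) \] and \[ E \text{ and } F \text{ are coexistent} \Longleftrightarrow \phi(E) \text{ and } \phi(F) \text{ are coexistent}. \] Then there exists an operator $U$ on $H$ which is either unitary or antiunitary such that \[ \phi(E)=UEU^* \qquad \text{for all } E\in\mathcal{E}(H). \]
   Context: For a complex Hilbert space $H$, $\mathcal{E}(H)$ denotes the set of all effects on $H$, i.e. the operator interval $[0,I]$ of all bounded self-adjoint operators $E$ on $H$ with $0\leq E\leq I$. The order $\leq$ is the usual order between bounded self-adjoint operators ($A\le B$ iff $B-A$ is positive semidefinite). Two effects $E,F\in\mathcal{E}(H)$ are called coexistent if there exist $A,B,C\in\mathcal{E}(H)$ such that $E=A+C$, $F=B+C$ and $A+B+C\in\mathcal{E}(H)$. An antiunitary operator is a conjugate-linear surjective isometry $U:H\to H$; for $U$ unitary or antiunitary, $U^*=U^{-1}$. *)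

theory Defs
  imports "HOL-Analysis.Analysis" "HOL-Library.Extended_Nat"
begin

section \<open>Complex Hilbert spaces\<close>

class complex_vector = real_vector +
  fixes scaleC :: "complex \<Rightarrow> 'a \<Rightarrow> 'a"  (infixr \<open>*\<^sub>C\<close> 75)
  assumes scaleC_add_right: "c *\<^sub>C (x + y) = c *\<^sub>C x + c *\<^sub>C y"
    and scaleC_add_left: "(c + d) *\<^sub>C x = c *\<^sub>C x + d *\<^sub>C x"
    and scaleC_scaleC: "c *\<^sub>C (d *\<^sub>C x) = (c * d) *\<^sub>C x"
    and scaleC_of_real: "complex_of_real r *\<^sub>C x = r *\<^sub>R x"

global_interpretation complex_vector: vector_space "scaleC :: complex \<Rightarrow> 'a \<Rightarrow> 'a::complex_vector"
  defines cspan_def: cspan = complex_vector.span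
    and cdim_def: cdim = complex_vector.dim
proof
  show "1 *\<^sub>C x = x" for x :: 'a
    using scaleC_of_real[of 1 x] by simp
qed (simp_all add: scaleC_add_right scaleC_add_left scaleC_scaleC)

text \<open>
  The complex inner product \<open>cinner\<close> is linear in its first argument. Positive definiteness
  and the fact that the norm is the one induced by \<open>cinner\<close> are inherited from the class
  \<^class>\<open>real_inner\<close>, because the real inner product is required to be the real part of \<open>cinner\<close>.
\<close>

class complex_inner = complex_vector + real_inner +
  fixes cinner :: "'a \<Rightarrow> 'a \<Rightarrow> complex"
  assumes cinner_commute: "cinner x y = cnj (cinner y x)"
    and cinner_add_left: "cinner (x + y) z = cinner x z + cinner y z"
    and cinner_scaleC_left: "cinner (c *\<^sub>C x) y = c * cinner x y"
    and inner_eq_Re_cinner: "inner x y = Re (cinner x y)"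

class complex_hilbert = complex_inner + complete_space

text \<open>
  The library's \<open>dim\<close> is a natural number, which is \<open>0\<close> on infinite-dimensional spaces;
  the dimension below is \<open>\<infinity>\<close> there.
\<close>

definition hilbert_dim :: "'a::complex_hilbert itself \<Rightarrow> enat" where
  "hilbert_dim _ =
    (if \<exists>B :: 'a set. finite B \<and> cspan B = UNIV then enat (cdim (UNIV :: 'a set)) else \<infinity>)"

section \<open>Effects\<close>

text \<open>
  Elements of \<open>'a \<Rightarrow>\<^sub>L 'a\<close> are bounded and real-linear, so complex homogeneity is stated separately.
\<close>

definition clinear_op :: "('a::complex_hilbert \<Rightarrow>\<^sub>L 'a) \<Rightarrow> bool" where
  "clinear_op T \<longleftrightarrow> (\<forall>c x. blinfun_apply T (c *\<^sub>C x) = c *\<^sub>C blinfun_apply T x)"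

definition selfadjoint_op :: "('a::complex_hilbert \<Rightarrow>\<^sub>L 'a) \<Rightarrow> bool" where
  "selfadjoint_op T \<longleftrightarrow>
    (\<forall>x y. cinner (blinfun_apply T x) y = cinner x (blinfun_apply T y))"

definition psd_op :: "('a::complex_hilbert \<Rightarrow>\<^sub>L 'a) \<Rightarrow> bool" where
  "psd_op T \<longleftrightarrow> (\<forall>x. cinner (blinfun_apply T x) x \<in> \<real>\<^sub>\<ge>\<^sub>0)"

definition op_le :: "('a::complex_hilbert \<Rightarrow>\<^sub>L 'a) \<Rightarrow> ('a \<Rightarrow>\<^sub>L 'a) \<Rightarrow> bool"  (infix \<open>\<preceq>\<close> 50) where
  "A \<preceq> B \<longleftrightarrow> psd_op (B - A)"

definition effects :: "('a::complex_hilbert \<Rightarrow>\<^sub>L 'a) set" where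
  "effects = {E. clinear_op E \<and> selfadjoint_op E \<and> 0 \<preceq> E \<and> E \<preceq> id_blinfun}"

definition coexistent :: "('a::complex_hilbert \<Rightarrow>\<^sub>L 'a) \<Rightarrow> ('a \<Rightarrow>\<^sub>L 'a) \<Rightarrow> bool" where
  "coexistent E F \<longleftrightarrow>
    (\<exists>A\<in>effects. \<exists>B\<in>effects. \<exists>C\<in>effects. E = A + C \<and> F = B + C \<and> A + B + C \<in> effects)"

section \<open>Unitary and antiunitary operators\<close>

text \<open>
  Both kinds of operator are surjective isometries, so they are bijective, and the adjoint
  \<open>U\<^sup>*\<close> is \<open>inv U\<close>.
\<close>

definition unitary_op :: "('a::complex_hilbert \<Rightarrow> 'a) \<Rightarrow> bool" where
  "unitary_op U \<longleftrightarrow>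
    (\<forall>x y. U (x + y) = U x + U y) \<and> (\<forall>c x. U (c *\<^sub>C x) = c *\<^sub>C U x) \<and>
    (\<forall>x. norm (U x) = norm x) \<and> surj U"

definition antiunitary_op :: "('a::complex_hilbert \<Rightarrow> 'a) \<Rightarrow> bool" where
  "antiunitary_op U \<longleftrightarrow>
    (\<forall>x y. U (x + y) = U x + U y) \<and> (\<forall>c x. U (c *\<^sub>C x) = cnj c *\<^sub>C U x) \<and>
    (\<forall>x. norm (U x) = norm x) \<and> surj U"

end

theory Submission
  imports Defs
begin

text \<open>
  The idea is to read off the action of \<open>\<phi>\<close> on rank-one operators and to reduce the theorem to
  Wigner's theorem. Write \<open>P\<^sub>x\<close> for the projection onto the ray of a unit vector \<open>x\<close>.

  An effect is a multiple \<open>t P\<^sub>x\<close> iff the effects below it form a chain, and the \<open>P\<^sub>x\<close> are the maximal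
  effects of this kind (\<open>maximal_chain_effect_iff\<close>); hence \<open>\<phi>\<close> permutes rank-one projections. An effect
  is scalar iff it coexists with every effect (\<open>scalar_iff_coexistent_with_all\<close>); hence
  \<open>\<phi> (t I) = f t I\<close> for an increasing bijection \<open>f\<close> of \<open>[0,1]\<close>, and since \<open>t P\<^sub>x \<preceq> s I\<close> iff \<open>t \<le> s\<close>, the
  same \<open>f\<close> rescales the multiples of every projection.

  It remains to find \<open>f\<close> and the change of the overlap \<open>p = \<bar>\<langle>x,y\<rangle>\<bar>\<^sup>2\<close> of two rays. The supremum of
  \<open>s I\<close> and \<open>P\<^sub>y\<close> is \<open>s I + (1 - s) P\<^sub>y\<close>, and \<open>t P\<^sub>x\<close> lies below it iff \<open>t ((1 - p) / s + p) \<le> 1\<close>. On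
  different rays, \<open>t P\<^sub>x\<close> and \<open>s P\<^sub>y\<close> coexist iff their sum is an effect, that is, iff
  \<open>t s p \<le> (1 - t) (1 - s)\<close>. In the coordinate \<open>w = 1 / s - 1\<close> these conditions say that \<open>f\<close> becomes a
  function \<open>F\<close> on the positive reals with \<open>F ((1 - p) w) = (1 - p') F w\<close> and \<open>F w F (p / w) = p'\<close>, where
  \<open>p'\<close> is the overlap of the image rays, and this forces \<open>F\<close> to be the identity (\<open>scale_rigidity\<close>). So
  \<open>f\<close> is the identity and overlaps are preserved. Wigner's theorem (\<open>wigner\<close>) then yields a unitary or
  antiunitary \<open>U\<close> with \<open>\<phi> (t P\<^sub>x) = U t P\<^sub>x U\<^sup>*\<close>.

  Finally, an effect is determined by the \<open>t P\<^sub>x\<close> below it (\<open>effects_eq_if_same_rank_ones\<close>), whence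
  \<open>\<phi> E = U E U\<^sup>*\<close> for all \<open>E\<close>. Bounds for operators come from the Cauchy-Schwarz inequality for
  positive forms, which gives the largest multiple of a rank-one projection below an operator
  (\<open>scaled_rank_one_le_iff\<close>).
\<close>

section \<open>Complex inner products\<close>

lemma cinner_add_right: "cinner x (y + z) = cinner x y + cinner (x::'a::complex_inner) z"
  by (simp only: cinner_commute[of x] cinner_add_left complex_cnj_add)

lemma cinner_scaleC_right: "cinner x (c *\<^sub>C y) = cnj c * cinner (x::'a::complex_inner) y"
  by (simp only: cinner_commute[of x] cinner_scaleC_left complex_cnj_mult)

lemma cinner_scaleR_left: "cinner (r *\<^sub>R x) y = of_real r * cinner (x::'a::complex_inner) y"
  by (metis cinner_scaleC_left scaleC_of_real)

lemma cinner_scaleR_right: "cinner x (r *\<^sub>R y) = of_real r * cinner (x::'a::complex_inner) y"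
  by (metis cinner_scaleC_right scaleC_of_real complex_cnj_complex_of_real)

lemma cinner_zero_left [simp]: "cinner 0 (y::'a::complex_inner) = 0"
  using cinner_scaleR_left[of 0 0 y] by simp

lemma cinner_zero_right [simp]: "cinner (y::'a::complex_inner) 0 = 0"
  using cinner_scaleR_right[of y 0 0] by simp

lemma cinner_minus_left [simp]: "cinner (- x) y = - cinner (x::'a::complex_inner) y"
  using cinner_scaleR_left[of "-1" x y] by simp

lemma cinner_minus_right [simp]: "cinner x (- y) = - cinner (x::'a::complex_inner) y"
  using cinner_scaleR_right[of x "-1" y] by simp

lemma cinner_diff_left: "cinner (x - y) z = cinner x z - cinner (y::'a::complex_inner) z"
  using cinner_add_left[of x "- y" z] by simp

lemma cinner_diff_right: "cinner x (y - z) = cinner x y - cinner (x::'a::complex_inner) z"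
  using cinner_add_right[of x y "- z"] by simp

lemmas cinner_expand = cinner_add_left cinner_add_right cinner_diff_left cinner_diff_right
  cinner_scaleC_left cinner_scaleC_right cinner_scaleR_left cinner_scaleR_right

lemma cinner_self: "cinner x x = of_real ((norm (x::'a::complex_inner))\<^sup>2)"
proof (rule complex_eqI)
  show "Im (cinner x x) = Im (of_real ((norm x)\<^sup>2))"
    using arg_cong[OF cinner_commute[of x x], of Im] by simp
qed (simp add: inner_eq_Re_cinner[symmetric] power2_norm_eq_inner)

lemma Im_cinner_eq: "Im (cinner x y) = - inner (\<i> *\<^sub>C x) (y::'a::complex_inner)"
  by (simp add: inner_eq_Re_cinner cinner_scaleC_left)

lemma norm_scaleC [simp]: "norm (c *\<^sub>C x) = cmod c * norm (x::'a::complex_inner)"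
proof -
  have "of_real ((norm (c *\<^sub>C x))\<^sup>2) = (c * cnj c) * cinner x x"
    by (simp only: cinner_self[symmetric] cinner_expand mult_ac)
  also have "\<dots> = of_real ((cmod c * norm x)\<^sup>2)"
    by (simp add: complex_norm_square[symmetric] cinner_self power_mult_distrib)
  finally have "(norm (c *\<^sub>C x))\<^sup>2 = (cmod c * norm x)\<^sup>2"
    by (simp only: of_real_eq_iff)
  then show ?thesis by (simp add: power2_eq_iff_nonneg)
qed

lemma scaleC_zero_right [simp]: "c *\<^sub>C (0::'a::complex_vector) = 0"
  by (rule complex_vector.scale_zero_right)

lemma scaleC_one [simp]: "1 *\<^sub>C (x::'a::complex_vector) = x"
  by (rule complex_vector.scale_one)

lemma cmod_cinner_commute: "cmod (cinner x y) = cmod (cinner y (x::'a::complex_inner))"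
  by (simp only: cinner_commute[of x y] complex_mod_cnj)

lemma cinner_mult_commuted: "cinner x y * cinner y x = of_real ((cmod (cinner x (y::'a::complex_inner)))\<^sup>2)"
  by (simp only: complex_norm_square cinner_commute[of y x])

text \<open>
  The phase of \<open>cinner x y\<close> can be absorbed into \<open>x\<close>; this turns inequalities for the real
  inner product into inequalities for the modulus of the complex one.
\<close>

lemma phase_rotation:
  obtains u where "cmod u = 1" "cinner (u *\<^sub>C x) y = of_real (cmod (cinner x (y::'a::complex_inner)))"
proof (cases "cinner x y = 0")
  case True
  then show thesis using that[of 1] by (simp add: cinner_scaleC_left)
next
  case False
  let ?c = "cinner x y"
  show thesis
  proof (rule that[of "cnj ?c / of_real (cmod ?c)"])
    show "cmod (cnj ?c / of_real (cmod ?c)) = 1"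
      using False by (simp add: norm_divide)
    show "cinner ((cnj ?c / of_real (cmod ?c)) *\<^sub>C x) y = of_real (cmod ?c)"
      using False complex_norm_square[of ?c]
      by (simp add: cinner_scaleC_left field_simps power2_eq_square)
  qed
qed

lemma cmod_cinner_le: "cmod (cinner x y) \<le> norm x * norm (y::'a::complex_inner)"
proof -
  obtain u where u: "cmod u = 1" "cinner (u *\<^sub>C x) y = of_real (cmod (cinner x y))"
    by (rule phase_rotation)
  have "inner (u *\<^sub>C x) y \<le> norm (u *\<^sub>C x) * norm y" by (rule norm_cauchy_schwarz)
  then show ?thesis using u by (simp add: inner_eq_Re_cinner)
qed

text \<open>
  Equality in the Cauchy-Schwarz inequality is how vectors on a common ray are recognised below.
\<close>

lemma parallel_if_cmod_cinner_eq:
  assumes "norm (x::'a::complex_inner) = 1" "cmod (cinner y x) = norm y"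
  shows "y = cinner y x *\<^sub>C x"
proof -
  let ?d = "y - cinner y x *\<^sub>C x"
  have "cinner ?d ?d = of_real ((norm y)\<^sup>2) - cinner y x * cinner x y"
    using assms(1) by (simp add: cinner_diff_left cinner_diff_right cinner_scaleC_left
        cinner_scaleC_right cinner_self[of x] cinner_self[of y])
  also have "\<dots> = 0" using assms(2) by (simp add: cinner_mult_commuted)
  finally have "norm ?d = 0" by (simp add: cinner_self)
  then show ?thesis by simp
qed

section \<open>Positive operators\<close>

text \<open>
  Complex-linear self-adjoint operators form a real vector space on which the order is decided by
  the real quadratic form \<open>inner (T x) x\<close>; this allows real arithmetic throughout.
\<close>

definition hermitian :: "('a::complex_hilbert \<Rightarrow>\<^sub>L 'a) \<Rightarrow> bool" where
  "hermitian T \<longleftrightarrow> clinear_op T \<and> selfadjoint_op T"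

definition positive_op :: "('a::complex_hilbert \<Rightarrow>\<^sub>L 'a) \<Rightarrow> bool" where
  "positive_op T \<longleftrightarrow> hermitian T \<and> (\<forall>x. 0 \<le> inner (T x) x)"

lemma hermitian_scaleC: "hermitian T \<Longrightarrow> blinfun_apply T (c *\<^sub>C x) = c *\<^sub>C blinfun_apply T x"
  by (simp add: hermitian_def clinear_op_def)

lemma hermitian_cinner: "hermitian T \<Longrightarrow> cinner (blinfun_apply T x) y = cinner x (blinfun_apply T y)"
  by (simp add: hermitian_def selfadjoint_op_def)

lemma hermitian_inner: "hermitian T \<Longrightarrow> inner (blinfun_apply T x) y = inner x (blinfun_apply T y)"
  by (simp add: inner_eq_Re_cinner hermitian_cinner)

lemma hermitian_cinner_self:
  assumes "hermitian T"
  shows "cinner (blinfun_apply T x) x = of_real (inner (blinfun_apply T x) x)"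
proof (rule complex_eqI)
  have "cinner (T x) x = cnj (cinner (T x) x)"
    using hermitian_cinner[OF assms, of x x] cinner_commute[of "T x" x] by simp
  from arg_cong[OF this, of Im] show "Im (cinner (T x) x) = Im (of_real (inner (T x) x))" by simp
qed (simp add: inner_eq_Re_cinner)

lemma hermitian_add: "hermitian S \<Longrightarrow> hermitian T \<Longrightarrow> hermitian (S + T)"
  by (simp add: hermitian_def clinear_op_def selfadjoint_op_def blinfun.add_left
      scaleC_add_right cinner_expand)

lemma hermitian_scaleR:
  assumes "hermitian T" shows "hermitian (r *\<^sub>R T)"
  using assms
  by (simp add: hermitian_def clinear_op_def selfadjoint_op_def blinfun.scaleR_left
      scaleC_of_real[symmetric] scaleC_scaleC cinner_expand mult.commute)

lemma hermitian_diff: "hermitian S \<Longrightarrow> hermitian T \<Longrightarrow> hermitian (S - T)"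
  using hermitian_add[of S "(-1) *\<^sub>R T"] hermitian_scaleR[of T "-1"] by simp

lemma hermitian_id: "hermitian id_blinfun"
  by (simp add: hermitian_def clinear_op_def selfadjoint_op_def)

lemma hermitian_0: "hermitian 0"
  by (simp add: hermitian_def clinear_op_def selfadjoint_op_def)

lemma psd_op_iff:
  assumes "hermitian T" shows "psd_op T \<longleftrightarrow> (\<forall>x. 0 \<le> inner (blinfun_apply T x) x)"
  by (simp add: psd_op_def hermitian_cinner_self[OF assms] complex_nonneg_Reals_iff)

lemma op_le_iff:
  assumes "hermitian S" "hermitian T"
  shows "S \<preceq> T \<longleftrightarrow> (\<forall>x. inner (blinfun_apply S x) x \<le> inner (blinfun_apply T x) x)"
  using psd_op_iff[OF hermitian_diff[OF assms(2,1)]]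
  by (simp add: op_le_def blinfun.diff_left inner_diff_left)

lemma effects_iff:
  "E \<in> effects \<longleftrightarrow> hermitian E \<and> (\<forall>x. 0 \<le> inner (blinfun_apply E x) x \<and> inner (blinfun_apply E x) x \<le> inner x x)"
proof (cases "hermitian E")
  case True
  then show ?thesis
    using op_le_iff[OF hermitian_0 True] op_le_iff[OF True hermitian_id]
    by (auto simp: effects_def hermitian_def)
qed (auto simp: effects_def hermitian_def)

lemma effects_hermitian: "E \<in> effects \<Longrightarrow> hermitian E"
  by (simp add: effects_iff)

lemma effects_positive: "E \<in> effects \<Longrightarrow> positive_op E"
  by (simp add: effects_iff positive_op_def)

lemma quadratic_nonneg_discriminant:
  fixes a b c :: real
  assumes a: "0 \<le> a" and quad: "\<And>r. 0 \<le> c + 2 * r * b + r\<^sup>2 * a"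
  shows "b\<^sup>2 \<le> c * a"
proof (cases "a = 0")
  case True
  have "b = 0"
  proof (rule ccontr)
    assume "b \<noteq> 0"
    then have "2 * (- (c + 1) / (2 * b)) * b = - (c + 1)" by simp
    then show False using quad[of "- (c + 1) / (2 * b)"] unfolding True by linarith
  qed
  then show ?thesis using True by simp
next
  case False
  then have "0 < a" using a by simp
  then have "a * (c + 2 * (- b / a) * b + (- b / a)\<^sup>2 * a) = c * a - b\<^sup>2"
    by (simp add: field_simps power2_eq_square)
  then show ?thesis using mult_nonneg_nonneg[OF a quad[of "- b / a"]] by linarith
qed

text \<open>
  Cauchy-Schwarz for the form of a positive operator: the real form is nonnegative on the line
  \<open>z + r y\<close>, where \<open>z\<close> is \<open>x\<close> with its phase adjusted. This inequality takes the place of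
  spectral theory and of square roots of operators in what follows.
\<close>

lemma positive_op_cauchy_schwarz:
  assumes "positive_op T"
  shows "(cmod (cinner (blinfun_apply T x) y))\<^sup>2 \<le> inner (blinfun_apply T x) x * inner (blinfun_apply T y) y"
proof -
  have herm: "hermitian T" and pos: "\<And>x. 0 \<le> inner (T x) x"
    using assms by (auto simp: positive_op_def)
  obtain u where u: "cmod u = 1" "cinner (u *\<^sub>C T x) y = of_real (cmod (cinner (T x) y))"
    by (rule phase_rotation)
  define z where "z = u *\<^sub>C x"
  have zy: "inner (T z) y = cmod (cinner (T x) y)"
    using u by (simp add: z_def hermitian_scaleC[OF herm] inner_eq_Re_cinner)
  have "inner (T z) z = Re ((u * cnj u) * cinner (T x) x)"
    by (simp only: z_def hermitian_scaleC[OF herm] inner_eq_Re_cinner cinner_expand mult_ac)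
  also have "u * cnj u = 1" using u(1) complex_norm_square[of u] by simp
  finally have zz: "inner (T z) z = inner (T x) x" by (simp add: inner_eq_Re_cinner)
  have quad: "0 \<le> inner (T z) z + 2 * r * inner (T z) y + r\<^sup>2 * inner (T y) y" for r
  proof -
    have "inner (T (z + r *\<^sub>R y)) (z + r *\<^sub>R y)
        = inner (T z) z + 2 * r * inner (T z) y + r\<^sup>2 * inner (T y) y"
      by (simp add: blinfun.add_right blinfun.scaleR_right inner_add_left inner_add_right
          power2_eq_square hermitian_inner[OF herm, of y z] inner_commute[of y "T z"] distrib_left)
    then show ?thesis using pos[of "z + r *\<^sub>R y"] by simp
  qed
  have "(inner (T z) y)\<^sup>2 \<le> inner (T z) z * inner (T y) y"
    by (rule quadratic_nonneg_discriminant) (use pos quad in auto)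
  then show ?thesis by (simp add: zy zz)
qed

lemma positive_op_apply_eq_0:
  assumes "positive_op T" "inner (blinfun_apply T x) x \<le> 0"
  shows "blinfun_apply T x = 0"
proof -
  have "inner (T x) x = 0" using assms by (simp add: positive_op_def order_antisym)
  then have "(cmod (cinner (T x) (T x)))\<^sup>2 \<le> 0"
    using positive_op_cauchy_schwarz[OF assms(1), of x "T x"] by simp
  then show ?thesis by (simp add: cinner_self)
qed

lemma op_le_antisym:
  assumes "hermitian S" "hermitian T" "S \<preceq> T" "T \<preceq> S"
  shows "S = T"
proof (rule blinfun_eqI)
  fix x
  have eq: "inner (S x) x = inner (T x) x" for x
    using assms op_le_iff[OF assms(1,2)] op_le_iff[OF assms(2,1)] by (auto intro: order_antisym)
  have "positive_op (T - S)"
    using eq hermitian_diff[OF assms(2,1)] by (simp add: positive_op_def blinfun.diff_left inner_diff_left)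
  then have "(T - S) x = 0"
    by (rule positive_op_apply_eq_0) (simp add: eq blinfun.diff_left inner_diff_left)
  then show "S x = T x" by (simp add: blinfun.diff_left)
qed

text \<open>
  An effect above a unit vector's projection acts as the identity on that vector, because \<open>I - E\<close>
  is positive with vanishing form there.
\<close>

lemma effect_fixes:
  assumes "E \<in> effects" "1 \<le> inner (blinfun_apply E x) x" "norm x = 1"
  shows "blinfun_apply E x = x"
proof -
  have "positive_op (id_blinfun - E)"
    using assms(1) by (auto simp: positive_op_def effects_iff hermitian_diff hermitian_id
        blinfun.diff_left inner_diff_left)
  then have "(id_blinfun - E) x = 0"
    by (rule positive_op_apply_eq_0)
      (use assms in \<open>simp add: blinfun.diff_left inner_diff_left power2_norm_eq_inner[symmetric]\<close>)
  then show ?thesis by (simp add: blinfun.diff_left)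
qed

section \<open>Rank-one operators\<close>

lift_definition rank_one :: "'a::complex_hilbert \<Rightarrow> 'a \<Rightarrow>\<^sub>L 'a" is "\<lambda>x y. cinner y x *\<^sub>C x"
proof (rule bounded_linear_intro)
  fix x y z :: 'a and r :: real
  show "cinner (y + z) x *\<^sub>C x = cinner y x *\<^sub>C x + cinner z x *\<^sub>C x"
    by (simp add: cinner_expand scaleC_add_left)
  show "cinner (r *\<^sub>R y) x *\<^sub>C x = r *\<^sub>R cinner y x *\<^sub>C x"
    by (simp add: cinner_expand scaleC_of_real[symmetric] scaleC_scaleC)
  show "norm (cinner y x *\<^sub>C x) \<le> norm y * (norm x * norm x)"
    using mult_right_mono[OF cmod_cinner_le[of y x], of "norm x"] by (simp add: mult.assoc)
qed

declare rank_one.rep_eq [simp]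

lemma hermitian_rank_one: "hermitian (rank_one x)"
  by (simp add: hermitian_def clinear_op_def selfadjoint_op_def cinner_expand scaleC_scaleC)
    (simp add: cinner_commute[of x] mult.commute)

lemma inner_rank_one: "inner (blinfun_apply (rank_one x) y) y = (cmod (cinner y x))\<^sup>2"
  by (simp add: inner_eq_Re_cinner cinner_scaleC_left cinner_mult_commuted)

lemma rank_one_scaleR: "rank_one (r *\<^sub>R x) = r\<^sup>2 *\<^sub>R rank_one x"
proof (rule blinfun_eqI)
  fix y
  have "rank_one (r *\<^sub>R x) y = (complex_of_real r * cinner y x) *\<^sub>C complex_of_real r *\<^sub>C x"
    by (simp only: rank_one.rep_eq cinner_scaleR_right scaleC_of_real)
  also have "\<dots> = complex_of_real (r\<^sup>2) *\<^sub>C cinner y x *\<^sub>C x"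
    by (simp add: scaleC_scaleC power2_eq_square mult_ac)
  finally show "rank_one (r *\<^sub>R x) y = (r\<^sup>2 *\<^sub>R rank_one x) y"
    by (simp only: scaleC_of_real rank_one.rep_eq blinfun.scaleR_left)
qed

lemma hermitian_scaled: "hermitian (t *\<^sub>R rank_one x)"
  by (simp add: hermitian_scaleR hermitian_rank_one)

lemma inner_scaled: "inner (blinfun_apply (t *\<^sub>R rank_one x) y) y = t * (cmod (cinner y x))\<^sup>2"
  by (simp only: blinfun.scaleR_left inner_scaleR_left inner_rank_one)

lemma cmod_cinner_le_unit: "norm x = 1 \<Longrightarrow> (cmod (cinner y x))\<^sup>2 \<le> inner y (y::'a::complex_inner)"
  using cmod_cinner_le[of y x] by (simp add: power2_norm_eq_inner[symmetric] power_mono)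

lemma scaled_effect: "norm x = 1 \<Longrightarrow> 0 \<le> t \<Longrightarrow> t \<le> 1 \<Longrightarrow> t *\<^sub>R rank_one x \<in> effects"
  using cmod_cinner_le_unit[of x]
  by (auto simp only: effects_iff hermitian_scaled inner_scaled
      intro!: mult_nonneg_nonneg zero_le_power2 order_trans[OF mult_left_le_one_le])

lemma rank_one_effect: "norm x = 1 \<Longrightarrow> rank_one x \<in> effects"
  using scaled_effect[of x 1] by simp

lemma cinner_unit: "norm x = 1 \<Longrightarrow> cinner x (x::'a::complex_inner) = 1"
  by (simp add: cinner_self)

lemma scaled_le_iff:
  assumes "norm x = 1"
  shows "s *\<^sub>R rank_one x \<preceq> t *\<^sub>R rank_one x \<longleftrightarrow> s \<le> t"
proof -
  have "s \<le> t" if "\<forall>y. s * (cmod (cinner y x))\<^sup>2 \<le> t * (cmod (cinner y x))\<^sup>2"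
    using that[rule_format, of x] assms by (simp add: cinner_unit)
  then show ?thesis
    by (auto simp only: op_le_iff[OF hermitian_scaled hermitian_scaled] inner_scaled
        intro!: mult_right_mono zero_le_power2)
qed

text \<open>
  The strength of an operator along a ray. Cauchy-Schwarz for the form of \<open>T\<close>, whose extremal case
  is the vector \<open>u\<close> itself, gives the largest multiple of the projection onto \<open>T u\<close> lying
  below \<open>T\<close> without inverting \<open>T\<close>.
\<close>

lemma scaled_rank_one_le_iff:
  assumes "positive_op T" "0 < inner (blinfun_apply T u) u" "0 \<le> t"
  shows "t *\<^sub>R rank_one (blinfun_apply T u) \<preceq> T \<longleftrightarrow> t * inner (blinfun_apply T u) u \<le> 1"
proof -
  let ?q = "inner (T u) u"
  have herm: "hermitian T" using assms(1) by (simp add: positive_op_def)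
  have le: "t *\<^sub>R rank_one (T u) \<preceq> T \<longleftrightarrow> (\<forall>y. t * (cmod (cinner y (T u)))\<^sup>2 \<le> inner (T y) y)"
    by (simp only: op_le_iff[OF hermitian_scaled herm] inner_scaled)
  show ?thesis
  proof
    assume "t *\<^sub>R rank_one (T u) \<preceq> T"
    then have "t * (cmod (cinner u (T u)))\<^sup>2 \<le> ?q" by (simp only: le)
    moreover have "cmod (cinner u (T u)) = ?q"
      using hermitian_cinner_self[OF herm, of u] assms(2) hermitian_cinner[OF herm, of u u] by simp
    ultimately have "(t * ?q) * ?q \<le> 1 * ?q" by (simp add: power2_eq_square mult.assoc)
    then show "t * ?q \<le> 1" using assms(2) by (simp only: mult_le_cancel_right_pos)
  next
    assume t: "t * ?q \<le> 1"
    have "t * (cmod (cinner y (T u)))\<^sup>2 \<le> inner (T y) y" for y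
    proof -
      have "0 \<le> inner (T y) y" using assms(1) by (simp add: positive_op_def)
      have "t * (cmod (cinner y (T u)))\<^sup>2 \<le> t * (?q * inner (T y) y)"
        using positive_op_cauchy_schwarz[OF assms(1), of u y] assms(3)
        by (simp add: cmod_cinner_commute[of y] mult_left_mono)
      also have "\<dots> \<le> 1 * inner (T y) y"
        using mult_right_mono[OF t \<open>0 \<le> inner (T y) y\<close>] by (simp add: mult.assoc)
      finally show ?thesis by simp
    qed
    then show "t *\<^sub>R rank_one (T u) \<preceq> T" unfolding le by blast
  qed
qed

lemma rank_one_normalize:
  assumes "x \<noteq> 0"
  shows "t *\<^sub>R rank_one x = (t * (norm x)\<^sup>2) *\<^sub>R rank_one (x /\<^sub>R norm x)"
proof -
  have "rank_one x = rank_one (norm x *\<^sub>R (x /\<^sub>R norm x))" using assms by simp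
  also have "\<dots> = (norm x)\<^sup>2 *\<^sub>R rank_one (x /\<^sub>R norm x)" by (rule rank_one_scaleR)
  finally show ?thesis by (metis scaleR_scaleR)
qed

text \<open>
  The extremal multiple from \<open>scaled_rank_one_le_iff\<close> has the same form as \<open>T\<close> at \<open>y\<close>, so the
  rank-one operators below \<open>T\<close> recover its form pointwise.
\<close>

lemma touching_rank_one:
  assumes "T \<in> effects" "blinfun_apply T y \<noteq> 0"
  obtains t where "0 < t" "t \<le> 1" "t *\<^sub>R rank_one (blinfun_apply T y /\<^sub>R norm (blinfun_apply T y)) \<preceq> T"
    "t * (cmod (cinner y (blinfun_apply T y /\<^sub>R norm (blinfun_apply T y))))\<^sup>2 = inner (blinfun_apply T y) y"
proof -
  have pos: "positive_op T" and herm: "hermitian T"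
    using assms(1) by (simp_all add: effects_positive effects_hermitian)
  let ?q = "inner (T y) y" and ?x = "T y /\<^sub>R norm (T y)"
  have q: "0 < ?q"
    using positive_op_apply_eq_0[OF pos] assms(2) by force
  define t where "t = (norm (T y))\<^sup>2 / ?q"
  have x: "norm ?x = 1" using assms(2) by simp
  have eq: "(1 / ?q) *\<^sub>R rank_one (T y) = t *\<^sub>R rank_one ?x"
    using rank_one_normalize[OF assms(2), of "1 / ?q"] by (simp add: t_def)
  have le: "t *\<^sub>R rank_one ?x \<preceq> T"
    using scaled_rank_one_le_iff[OF pos q, of "1 / ?q"] q by (simp only: eq) simp
  have cyT: "cmod (cinner y (T y)) = ?q"
    using hermitian_cinner_self[OF herm, of y] hermitian_cinner[OF herm, of y y] q by simp
  have touch: "t * (cmod (cinner y ?x))\<^sup>2 = ?q"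
    using inner_scaled[of "1 / ?q" "T y" y] q cyT unfolding eq
    by (simp only: inner_scaled) (simp add: power2_eq_square)
  have "t \<le> 1"
  proof -
    have "t * (cmod (cinner ?x ?x))\<^sup>2 \<le> inner (T ?x) ?x"
      using le by (simp only: op_le_iff[OF hermitian_scaled herm] inner_scaled)
    also have "\<dots> \<le> inner ?x ?x" using assms(1) unfolding effects_iff by blast
    finally show ?thesis using x cinner_unit[OF x] by (simp only: power2_norm_eq_inner[symmetric]) simp
  qed
  moreover have "0 < t" using q assms(2) by (simp add: t_def)
  ultimately show thesis using that le touch by blast
qed

text \<open>
  An effect is thus the supremum of the multiples of rank-one projections below it: test the
  inequality at \<open>y\<close> with the operator that touches \<open>S\<close> there.
\<close>

lemma op_le_if_rank_ones_le:
  assumes "S \<in> effects" "positive_op T"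
    and "\<And>t x. norm x = 1 \<Longrightarrow> 0 \<le> t \<Longrightarrow> t \<le> 1 \<Longrightarrow> t *\<^sub>R rank_one x \<preceq> S \<Longrightarrow> t *\<^sub>R rank_one x \<preceq> T"
  shows "S \<preceq> T"
proof -
  have herm: "hermitian T" using assms(2) by (simp add: positive_op_def)
  have "inner (S y) y \<le> inner (T y) y" for y
  proof (cases "S y = 0")
    case True
    then show ?thesis using assms(2) by (simp add: positive_op_def)
  next
    case False
    let ?x = "S y /\<^sub>R norm (S y)"
    obtain t where t: "0 < t" "t \<le> 1" "t *\<^sub>R rank_one ?x \<preceq> S"
      "t * (cmod (cinner y ?x))\<^sup>2 = inner (S y) y"
      using touching_rank_one[OF assms(1) False] .
    have "t *\<^sub>R rank_one ?x \<preceq> T"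
      using t False by (intro assms(3)) simp_all
    then have "t * (cmod (cinner y ?x))\<^sup>2 \<le> inner (T y) y"
      by (simp only: op_le_iff[OF hermitian_scaled herm] inner_scaled)
    then show ?thesis by (simp only: t(4))
  qed
  then show ?thesis by (simp only: op_le_iff[OF effects_hermitian[OF assms(1)] herm]) blast
qed

lemma effects_eq_if_same_rank_ones:
  assumes "S \<in> effects" "T \<in> effects"
    and "\<And>t x. norm x = 1 \<Longrightarrow> 0 \<le> t \<Longrightarrow> t \<le> 1 \<Longrightarrow> t *\<^sub>R rank_one x \<preceq> S \<longleftrightarrow> t *\<^sub>R rank_one x \<preceq> T"
  shows "S = T"
proof (rule op_le_antisym)
  show "S \<preceq> T"
    by (rule op_le_if_rank_ones_le) (use assms effects_positive in blast)+
  show "T \<preceq> S"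
    by (rule op_le_if_rank_ones_le) (use assms effects_positive in blast)+
qed (use assms effects_hermitian in blast)+

text \<open>
  An effect below a rank-one projection has its kernel, hence by self-adjointness also its range,
  controlled by that projection.
\<close>

lemma below_rank_one:
  assumes "A \<in> effects" "A \<preceq> t *\<^sub>R rank_one x" "norm x = 1"
  obtains s where "0 \<le> s" "s \<le> 1" "A = s *\<^sub>R rank_one x"
proof -
  have herm: "hermitian A" and pos: "positive_op A"
    using assms(1) by (simp_all add: effects_positive effects_hermitian)
  have le: "inner (A y) y \<le> t * (cmod (cinner y x))\<^sup>2" for y
    using assms(2) by (simp only: op_le_iff[OF herm hermitian_scaled] inner_scaled)
  have ker: "A y = 0" if "cinner y x = 0" for y
    by (rule positive_op_apply_eq_0[OF pos]) (use le[of y] that in simp)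
  have dec: "A y = cinner y x *\<^sub>C A x" for y
  proof -
    have "A (y - cinner y x *\<^sub>C x) = 0"
      by (rule ker) (simp add: cinner_expand cinner_unit[OF assms(3)])
    then show ?thesis by (simp add: blinfun.diff_right hermitian_scaleC[OF herm])
  qed
  define s where "s = inner (A x) x"
  have "A x = s *\<^sub>R x"
  proof -
    let ?d = "A x - s *\<^sub>R x"
    have Axx: "cinner (A x) x = of_real s"
      using hermitian_cinner_self[OF herm, of x] by (simp add: s_def)
    then have dx: "cinner ?d x = 0"
      using assms(3) by (simp add: cinner_expand cinner_unit)
    have "cinner (A x) ?d = cinner x (A ?d)" by (rule hermitian_cinner[OF herm])
    then have "cinner (A x) ?d = 0" using ker[OF dx] by simp
    moreover have "cinner x ?d = 0" using dx cinner_commute[of x ?d] by simp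
    ultimately have "cinner ?d ?d = 0"
      by (simp only: cinner_diff_left[of "A x" "s *\<^sub>R x" ?d] cinner_scaleR_left) simp
    then show ?thesis by (simp add: cinner_self)
  qed
  then have "A y = cinner y x *\<^sub>C s *\<^sub>R x" for y using dec[of y] by (simp only:)
  then have "A = s *\<^sub>R rank_one x"
    by (intro blinfun_eqI)
      (simp add: blinfun.scaleR_left scaleC_of_real[symmetric] scaleC_scaleC mult.commute)
  moreover have "0 \<le> s" "s \<le> 1"
    using assms(1,3) power2_norm_eq_inner[of x] unfolding effects_iff s_def by (metis, metis one_power2)
  ultimately show thesis using that by blast
qed

lemma rank_one_eq_iff:
  assumes "norm (x::'a::complex_hilbert) = 1" "norm y = 1"
  shows "rank_one x = rank_one y \<longleftrightarrow> cmod (cinner x y) = 1"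
proof
  assume eq: "rank_one x = rank_one y"
  have "(cmod (cinner x x))\<^sup>2 = (cmod (cinner x y))\<^sup>2"
    by (simp only: inner_rank_one[symmetric] eq)
  then show "cmod (cinner x y) = 1"
    using assms power2_eq_imp_eq[of "cmod (cinner x y)" 1] by (simp add: cinner_unit)
next
  assume c: "cmod (cinner x y) = 1"
  let ?c = "cinner x y"
  have x: "x = ?c *\<^sub>C y" by (rule parallel_if_cmod_cinner_eq) (simp_all add: assms c)
  have 1: "cnj ?c * ?c = 1"
    using c complex_norm_square[of ?c] by (simp add: mult.commute)
  show "rank_one x = rank_one y"
  proof (rule blinfun_eqI)
    fix z
    have "rank_one x z = (cnj ?c * cinner z y * ?c) *\<^sub>C y"
    proof -
      have "rank_one x z = cinner z (?c *\<^sub>C y) *\<^sub>C ?c *\<^sub>C y"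
        unfolding x[symmetric] by simp
      then show ?thesis by (simp only: cinner_scaleC_right scaleC_scaleC)
    qed
    also have "\<dots> = (cinner z y * (cnj ?c * ?c)) *\<^sub>C y" by (simp only: mult_ac)
    finally show "rank_one x z = rank_one y z" by (simp add: 1)
  qed
qed

text \<open>
  By \<open>below_rank_one\<close> the comparison is an equality \<open>s P\<^sub>x = r P\<^sub>y\<close>; evaluating it at \<open>x\<close> and at \<open>y\<close>
  squeezes the overlap of the two rays to \<open>1\<close>.
\<close>

lemma scaled_le_imp_parallel:
  assumes "norm x = 1" "norm y = 1" "0 < s" "0 \<le> t" "t \<le> 1" "s \<le> 1" "s *\<^sub>R rank_one x \<preceq> t *\<^sub>R rank_one y"
  shows "cmod (cinner x y) = 1" "s \<le> t"
proof -
  obtain r where r: "0 \<le> r" "r \<le> 1" "s *\<^sub>R rank_one x = r *\<^sub>R rank_one y"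
    by (rule below_rank_one[OF scaled_effect assms(7)]) (use assms in auto)
  have eq: "s * (cmod (cinner z x))\<^sup>2 = r * (cmod (cinner z y))\<^sup>2" for z
    by (simp only: inner_scaled[symmetric] r(3))
  have x: "s = r * (cmod (cinner x y))\<^sup>2"
    using eq[of x] assms(1) by (simp add: cinner_unit)
  have y: "s * (cmod (cinner x y))\<^sup>2 = r"
    using eq[of y] assms(2) by (simp add: cinner_unit cmod_cinner_commute[of y x])
  have le1: "(cmod (cinner x y))\<^sup>2 \<le> 1"
    using cmod_cinner_le_unit[OF assms(2), of x] assms(1) power2_norm_eq_inner[of x] by simp
  have "r \<le> s" using y le1 assms(3) mult_left_mono[OF le1, of s] by simp
  moreover have "s \<le> r" using x le1 r mult_left_mono[OF le1, of r] by simp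
  ultimately have "r = s" by simp
  then have "(cmod (cinner x y))\<^sup>2 = 1" using y assms(3) by simp
  then show 1: "cmod (cinner x y) = 1" using power2_eq_imp_eq[of "cmod (cinner x y)" 1] by simp
  have "rank_one x = rank_one y" using rank_one_eq_iff assms(1,2) 1 by blast
  then show "s \<le> t" using assms(7) scaled_le_iff[OF assms(2)] by simp
qed

section \<open>Rank-one effects in terms of the order\<close>

definition chain_effect :: "('a::complex_hilbert \<Rightarrow>\<^sub>L 'a) \<Rightarrow> bool" where
  "chain_effect E \<longleftrightarrow> E \<in> effects \<and>
    (\<forall>A\<in>effects. \<forall>B\<in>effects. A \<preceq> E \<longrightarrow> B \<preceq> E \<longrightarrow> A \<preceq> B \<or> B \<preceq> A)"

lemma chain_effect_scaled:
  assumes "norm x = 1" "0 \<le> t" "t \<le> 1"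
  shows "chain_effect (t *\<^sub>R rank_one x)"
  unfolding chain_effect_def
proof (intro conjI ballI impI)
  show "t *\<^sub>R rank_one x \<in> effects" using assms by (rule scaled_effect)
  fix A B
  assume A: "A \<in> effects" "A \<preceq> t *\<^sub>R rank_one x" and B: "B \<in> effects" "B \<preceq> t *\<^sub>R rank_one x"
  obtain r where r: "A = r *\<^sub>R rank_one x" using below_rank_one[OF A assms(1)] by blast
  obtain s where s: "B = s *\<^sub>R rank_one x" using below_rank_one[OF B assms(1)] by blast
  show "A \<preceq> B \<or> B \<preceq> A"
    unfolding r s scaled_le_iff[OF assms(1)] by linarith
qed

text \<open>
  If \<open>E\<close> is not a multiple of a projection, it has two linearly independent values, and
  \<open>touching_rank_one\<close> produces an incomparable pair below \<open>E\<close>.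
\<close>

lemma chain_effect_imp_scaled:
  fixes e :: "'a::complex_hilbert"
  assumes "chain_effect E" "norm e = 1"
  obtains t and x :: 'a where "norm x = 1" "0 \<le> t" "t \<le> 1" "E = t *\<^sub>R rank_one x"
proof (cases "\<exists>y. blinfun_apply E y \<noteq> 0")
  case False
  then have "E = 0 *\<^sub>R rank_one e" by (intro blinfun_eqI) simp
  then show thesis using that[of e 0] assms(2) by simp
next
  case True
  have E: "E \<in> effects" using assms(1) by (simp add: chain_effect_def)
  have herm: "hermitian E" using E by (rule effects_hermitian)
  obtain y where y: "E y \<noteq> 0" using True by blast
  define x where "x = E y /\<^sub>R norm (E y)"
  have x: "norm x = 1" using y by (simp add: x_def)
  have range: "E z = cinner (E z) x *\<^sub>C x" for z
  proof (cases "E z = 0")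
    case False
    let ?w = "E z /\<^sub>R norm (E z)"
    have w: "norm ?w = 1" using False by simp
    obtain s where s: "0 < s" "s \<le> 1" "s *\<^sub>R rank_one x \<preceq> E"
      using touching_rank_one[OF E y] unfolding x_def by blast
    obtain t where t: "0 < t" "t \<le> 1" "t *\<^sub>R rank_one ?w \<preceq> E"
      using touching_rank_one[OF E False] by blast
    have "s *\<^sub>R rank_one x \<in> effects" "t *\<^sub>R rank_one ?w \<in> effects"
      using s t x w by (auto intro!: scaled_effect)
    then have "s *\<^sub>R rank_one x \<preceq> t *\<^sub>R rank_one ?w \<or> t *\<^sub>R rank_one ?w \<preceq> s *\<^sub>R rank_one x"
      using assms(1) s(3) t(3) unfolding chain_effect_def by blast
    then have "cmod (cinner x ?w) = 1"
    proof
      assume le: "s *\<^sub>R rank_one x \<preceq> t *\<^sub>R rank_one ?w"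
      show ?thesis by (rule scaled_le_imp_parallel(1)[OF x w _ _ _ _ le]) (use s t in simp_all)
    next
      assume le: "t *\<^sub>R rank_one ?w \<preceq> s *\<^sub>R rank_one x"
      have "cmod (cinner ?w x) = 1"
        by (rule scaled_le_imp_parallel(1)[OF w x _ _ _ _ le]) (use s t in simp_all)
      then show ?thesis by (simp only: cmod_cinner_commute[of x])
    qed
    then have "cmod (cinner (E z) x) = norm (E z)"
      using False
      by (simp add: cinner_scaleR_right norm_divide cmod_cinner_commute[of x] divide_simps)
    then show ?thesis by (rule parallel_if_cmod_cinner_eq[OF x])
  qed simp
  have dec: "E z = cinner z (E x) *\<^sub>C x" for z
    using range[of z] by (simp only: hermitian_cinner[OF herm])
  define t where "t = inner (E x) x"
  have "cinner (E x) x = of_real t"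
    using hermitian_cinner_self[OF herm, of x] by (simp add: t_def)
  then have Ex: "E x = complex_of_real t *\<^sub>C x" using range[of x] by simp
  have "E = t *\<^sub>R rank_one x"
  proof (rule blinfun_eqI)
    fix z
    have "E z = cinner z (complex_of_real t *\<^sub>C x) *\<^sub>C x" using dec[of z] by (simp only: Ex)
    then show "E z = (t *\<^sub>R rank_one x) z"
      by (simp add: blinfun.scaleR_left cinner_scaleC_right scaleC_of_real[symmetric] scaleC_scaleC)
  qed
  moreover have "0 \<le> t" "t \<le> 1"
    using E x power2_norm_eq_inner[of x] unfolding effects_iff t_def by (metis, metis one_power2)
  ultimately show thesis using that x by blast
qed

text \<open>
  All multiples of a projection are chain effects; maximality singles out the projection itself,
  because chain effects on different rays are never comparable unless one of them is \<open>0\<close>.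
\<close>

lemma maximal_chain_effect_iff:
  fixes e :: "'a::complex_hilbert"
  assumes "norm e = 1"
  shows "(chain_effect E \<and> (\<forall>F. chain_effect F \<longrightarrow> E \<preceq> F \<longrightarrow> F = E)) \<longleftrightarrow>
    (\<exists>x::'a. norm x = 1 \<and> E = rank_one x)" (is "?l \<longleftrightarrow> ?r")
proof
  assume l: ?l
  obtain t and x :: 'a where x: "norm x = 1" "0 \<le> t" "t \<le> 1" "E = t *\<^sub>R rank_one x"
    using chain_effect_imp_scaled[OF conjunct1[OF l] assms] by blast
  have "E \<preceq> 1 *\<^sub>R rank_one x" using x scaled_le_iff[OF x(1)] by blast
  then have "rank_one x = E" using l chain_effect_scaled[OF x(1), of 1] by simp
  then show ?r using x(1) by blast
next
  assume ?r
  then obtain x where x: "norm x = 1" "E = rank_one x" by blast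
  have "F = E" if F: "chain_effect F" "E \<preceq> F" for F
  proof -
    obtain t and y :: 'a where y: "norm y = 1" "0 \<le> t" "t \<le> 1" "F = t *\<^sub>R rank_one y"
      using chain_effect_imp_scaled[OF F(1) assms] by blast
    have "1 *\<^sub>R rank_one x \<preceq> t *\<^sub>R rank_one y" using F(2) x(2) y(4) by simp
    then have "cmod (cinner x y) = 1" "1 \<le> t"
      using scaled_le_imp_parallel[OF x(1) y(1), of 1 t] y by simp_all
    then have "rank_one x = rank_one y" "t = 1" using rank_one_eq_iff[OF x(1) y(1)] y by simp_all
    then show ?thesis using x y by simp
  qed
  then show ?l using chain_effect_scaled[OF x(1), of 1] x(2) by simp
qed

section \<open>Scalar effects and coexistence\<close>

lemma scalar_effect: "0 \<le> t \<Longrightarrow> t \<le> 1 \<Longrightarrow> t *\<^sub>R id_blinfun \<in> effects"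
  by (auto simp: effects_iff hermitian_scaleR hermitian_id blinfun.scaleR_left
      intro: mult_left_le_one_le)

lemma coexistent_scalar:
  assumes F: "F \<in> effects" and t: "0 \<le> t" "t \<le> 1"
  shows "coexistent (t *\<^sub>R id_blinfun) F"
proof -
  have qF: "0 \<le> inner (F x) x" "inner (F x) x \<le> inner x x" for x
    using F by (auto simp: effects_iff)
  have scale: "r *\<^sub>R G \<in> effects" if "G \<in> effects" "0 \<le> r" "r \<le> 1" for r and G :: "'a \<Rightarrow>\<^sub>L 'a"
    using that by (auto simp: effects_iff hermitian_scaleR blinfun.scaleR_left
        intro!: order_trans[OF mult_left_le_one_le])
  have compl: "id_blinfun - F \<in> effects"
    using qF effects_hermitian[OF F]
    by (auto simp: effects_iff hermitian_diff hermitian_id blinfun.diff_left inner_diff_left)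
  show ?thesis
    unfolding coexistent_def
  proof (intro bexI conjI)
    show "t *\<^sub>R id_blinfun = t *\<^sub>R (id_blinfun - F) + t *\<^sub>R F"
      by (simp add: scaleR_right_diff_distrib)
    show "F = (1 - t) *\<^sub>R F + t *\<^sub>R F" by (simp add: scaleR_left_diff_distrib)
    have "t *\<^sub>R (id_blinfun - F) + (1 - t) *\<^sub>R F + t *\<^sub>R F
        = id_blinfun - (1 - t) *\<^sub>R (id_blinfun - F)"
      by (simp add: algebra_simps)
    moreover have "(1 - t) *\<^sub>R (id_blinfun - F) \<in> effects" using scale[OF compl] t by simp
    then have "id_blinfun - (1 - t) *\<^sub>R (id_blinfun - F) \<in> effects"
      by (auto simp: effects_iff hermitian_diff hermitian_id blinfun.diff_left inner_diff_left)
    ultimately show "t *\<^sub>R (id_blinfun - F) + (1 - t) *\<^sub>R F + t *\<^sub>R F \<in> effects" by simp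
  qed (use scale[OF compl] scale[OF F] t in auto)
qed

text \<open>
  The common part of \<open>E\<close> and a rank-one projection is a multiple of that projection, and the
  rest of \<open>E\<close> annihilates its range.
\<close>

lemma coexistent_rank_one_imp_eigenvector:
  assumes "coexistent E (rank_one x)" "norm x = 1"
  shows "\<exists>s::real. blinfun_apply E x = s *\<^sub>R x"
proof -
  obtain A B C where ABC: "A \<in> effects" "B \<in> effects" "C \<in> effects" "E = A + C"
    "rank_one x = B + C" "A + B + C \<in> effects"
    using assms(1) unfolding coexistent_def by blast
  have "inner (C y) y \<le> inner (rank_one x y) y" for y
    unfolding ABC(5) using ABC(2) by (simp add: effects_iff blinfun.add_left inner_add_left)
  then have "C \<preceq> 1 *\<^sub>R rank_one x"
    using op_le_iff[OF effects_hermitian[OF ABC(3)] hermitian_rank_one] by simp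
  then obtain s where s: "C = s *\<^sub>R rank_one x"
    using below_rank_one[OF ABC(3) _ assms(2)] by blast
  have "inner (A x) x + inner (rank_one x x) x \<le> inner x x"
    using ABC(6) unfolding ABC(5) by (simp add: effects_iff blinfun.add_left inner_add_left add.assoc)
  then have "inner (A x) x \<le> 0"
    using assms(2) power2_norm_eq_inner[of x] by (simp only: inner_rank_one cinner_unit) simp
  then have "A x = 0" by (rule positive_op_apply_eq_0[OF effects_positive[OF ABC(1)]])
  then have "E x = s *\<^sub>R x"
    using assms(2) by (simp add: ABC(4) s blinfun.add_left blinfun.scaleR_left cinner_unit)
  then show ?thesis by blast
qed

lemma scalar_if_all_eigenvectors:
  fixes e :: "'a::complex_hilbert" and E :: "'a \<Rightarrow>\<^sub>L 'a"
  assumes "E \<in> effects" "norm e = 1" "\<And>x. norm x = 1 \<Longrightarrow> \<exists>s::real. blinfun_apply E x = s *\<^sub>R x"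
  obtains t where "0 \<le> t" "t \<le> 1" "E = t *\<^sub>R id_blinfun"
proof -
  have herm: "hermitian E" using assms(1) by (rule effects_hermitian)
  obtain t where t: "E e = t *\<^sub>R e" using assms(2,3) by blast
  have ex: "\<exists>s::real. E x = s *\<^sub>R x" for x
  proof (cases "x = 0")
    case False
    then obtain s where "E (x /\<^sub>R norm x) = s *\<^sub>R (x /\<^sub>R norm x)"
      using assms(3)[of "x /\<^sub>R norm x"] by auto
    then have "norm x *\<^sub>R E (x /\<^sub>R norm x) = s *\<^sub>R (norm x *\<^sub>R (x /\<^sub>R norm x))" by simp
    then show ?thesis using False by (auto simp: blinfun.scaleR_right)
  qed simp
  \<comment> \<open>The eigenvalue at \<open>x\<close> agrees with that at \<open>e\<close> because \<open>e + x\<close> is an eigenvector, too.\<close>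
  have perp: "E x = t *\<^sub>R x" if "cinner x e = 0" for x
  proof -
    obtain s where s: "E x = s *\<^sub>R x" using ex by blast
    obtain r where r: "E (e + x) = r *\<^sub>R (e + x)" using ex by blast
    have eq: "(t - r) *\<^sub>R e + (s - r) *\<^sub>R x = 0"
      using r by (simp add: blinfun.add_right s t algebra_simps)
    have "cinner ((t - r) *\<^sub>R e + (s - r) *\<^sub>R x) e = 0" by (simp only: eq cinner_zero_left)
    then have "t = r" using that assms(2) by (simp add: cinner_expand cinner_unit)
    then show ?thesis using eq s by auto
  qed
  have "E = t *\<^sub>R id_blinfun"
  proof (rule blinfun_eqI)
    fix y
    let ?z = "y - cinner y e *\<^sub>C e"
    have "cinner ?z e = 0" using assms(2) by (simp add: cinner_expand cinner_unit)
    then have "E ?z = t *\<^sub>R ?z" by (rule perp)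
    then have "E y = t *\<^sub>R ?z + cinner y e *\<^sub>C t *\<^sub>R e"
      by (simp add: blinfun.diff_right hermitian_scaleC[OF herm] t algebra_simps)
    also have "\<dots> = t *\<^sub>R y"
      by (simp add: algebra_simps scaleC_of_real[symmetric] scaleC_scaleC mult.commute)
    finally show "E y = (t *\<^sub>R id_blinfun) y" by (simp add: blinfun.scaleR_left)
  qed
  moreover have "0 \<le> t" "t \<le> 1"
    using assms(1,2) t power2_norm_eq_inner[of e] by (auto simp: effects_iff dest!: spec[of _ e])
  ultimately show thesis using that by blast
qed

lemma scalar_iff_coexistent_with_all:
  fixes e :: "'a::complex_hilbert" and E :: "'a \<Rightarrow>\<^sub>L 'a"
  assumes "E \<in> effects" "norm e = 1"
  shows "(\<forall>F\<in>effects. coexistent E F) \<longleftrightarrow> (\<exists>t. 0 \<le> t \<and> t \<le> 1 \<and> E = t *\<^sub>R id_blinfun)"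
proof
  assume "\<forall>F\<in>effects. coexistent E F"
  then have "\<exists>s::real. E x = s *\<^sub>R x" if "norm x = 1" for x
    using that by (intro coexistent_rank_one_imp_eigenvector) (auto intro: rank_one_effect)
  from scalar_if_all_eigenvectors[OF assms this]
  show "\<exists>t. 0 \<le> t \<and> t \<le> 1 \<and> E = t *\<^sub>R id_blinfun" by blast
qed (use coexistent_scalar in auto)

lemma scalar_le_iff:
  fixes e :: "'a::complex_hilbert"
  assumes "norm e = 1"
  shows "s *\<^sub>R id_blinfun \<preceq> (t *\<^sub>R id_blinfun :: 'a \<Rightarrow>\<^sub>L 'a) \<longleftrightarrow> s \<le> t"
proof -
  have "s \<le> t" if "\<forall>y::'a. s * inner y y \<le> t * inner y y"
    using that[rule_format, of e] assms power2_norm_eq_inner[of e] by simp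
  then show ?thesis
    by (auto simp: op_le_iff hermitian_scaleR hermitian_id blinfun.scaleR_left intro: mult_right_mono)
qed

lemma scaled_le_scalar_iff:
  assumes "norm x = 1" "0 \<le> t"
  shows "t *\<^sub>R rank_one x \<preceq> s *\<^sub>R id_blinfun \<longleftrightarrow> t \<le> s"
proof -
  have 1: "t *\<^sub>R rank_one x \<preceq> s *\<^sub>R id_blinfun \<longleftrightarrow> (\<forall>y. t * (cmod (cinner y x))\<^sup>2 \<le> s * inner y y)"
    by (simp only: op_le_iff[OF hermitian_scaled hermitian_scaleR[OF hermitian_id]] inner_scaled)
      (simp add: blinfun.scaleR_left)
  have "t \<le> s" if "\<forall>y. t * (cmod (cinner y x))\<^sup>2 \<le> s * inner y y"
    using that[rule_format, of x] assms power2_norm_eq_inner[of x] by (simp add: cinner_unit)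
  moreover have "t * (cmod (cinner y x))\<^sup>2 \<le> s * inner y y" if "t \<le> s" for y
    using mult_mono[OF that cmod_cinner_le_unit[OF assms(1), of y]] assms(2) that by simp
  ultimately show ?thesis unfolding 1 by blast
qed

section \<open>Perturbations of scalars by a projection\<close>

text \<open>
  For a unit vector \<open>y\<close> this operator has eigenvalue \<open>a + b\<close> on the ray of \<open>y\<close> and \<open>a\<close> on its
  orthogonal complement. The case \<open>(s, 1 - s)\<close> describes suprema of scalars and projections, the
  case \<open>(1, - s)\<close> the complement of a multiple of a projection.
\<close>

definition two_level :: "real \<Rightarrow> real \<Rightarrow> 'a::complex_hilbert \<Rightarrow> 'a \<Rightarrow>\<^sub>L 'a" where
  "two_level a b y = a *\<^sub>R id_blinfun + b *\<^sub>R rank_one y"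

lemma hermitian_two_level: "hermitian (two_level a b y)"
  by (simp add: two_level_def hermitian_add hermitian_scaleR hermitian_id hermitian_rank_one)

lemma inner_two_level:
  "inner (blinfun_apply (two_level a b y) z) z = a * inner z z + b * (cmod (cinner z y))\<^sup>2"
proof -
  have "inner (blinfun_apply (two_level a b y) z) z = a * inner z z + inner (blinfun_apply (b *\<^sub>R rank_one y) z) z"
    by (simp add: two_level_def blinfun.add_left blinfun.scaleR_left inner_add_left)
  then show ?thesis by (simp only: inner_scaled)
qed

lemma inner_decompose:
  assumes "norm y = 1"
  shows "inner z z = (cmod (cinner z y))\<^sup>2 + inner (z - cinner z y *\<^sub>C y) (z - cinner z y *\<^sub>C (y::'a::complex_inner))"
proof -
  let ?w = "z - cinner z y *\<^sub>C y"
  have "cinner ?w y = 0" using assms by (simp add: cinner_expand cinner_unit)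
  then have "cinner ?w ?w = cinner ?w z" by (simp add: cinner_diff_right cinner_scaleC_right)
  also have "\<dots> = cinner z z - cinner z y * cinner y z" by (simp add: cinner_diff_left cinner_scaleC_left)
  finally show ?thesis by (simp add: cinner_mult_commuted inner_eq_Re_cinner)
qed

lemma inner_two_level_decompose:
  assumes "norm y = 1"
  shows "inner (blinfun_apply (two_level a b y) z) z = (a + b) * (cmod (cinner z y))\<^sup>2
      + a * inner (z - cinner z y *\<^sub>C y) (z - cinner z y *\<^sub>C y)"
  unfolding inner_two_level using inner_decompose[OF assms, of z] by (simp add: distrib_left distrib_right)

lemma positive_two_level:
  assumes "norm y = 1" "0 \<le> a" "0 \<le> a + b"
  shows "positive_op (two_level a b y)"
  using assms by (simp add: positive_op_def hermitian_two_level inner_two_level_decompose)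

lemma two_level_effect:
  assumes "norm y = 1" "0 \<le> a" "0 \<le> a + b" "a \<le> 1" "a + b \<le> 1"
  shows "two_level a b y \<in> effects"
proof -
  have "inner (two_level a b y z) z \<le> inner z z" for z
    unfolding inner_two_level_decompose[OF assms(1)] unfolding inner_decompose[OF assms(1), of z]
    using assms by (intro add_mono) (simp_all add: mult_left_le_one_le)
  then show ?thesis
    using positive_two_level[OF assms(1-3)] by (simp add: effects_iff positive_op_def)
qed

text \<open>
  The vector \<open>u = (two_level a b y)\<inverse> x\<close> is explicit, so \<open>scaled_rank_one_le_iff\<close> becomes a
  scalar inequality.
\<close>

lemma scaled_le_two_level_iff:
  assumes "norm x = 1" "norm y = 1" "0 < a" "0 < a + b" "0 \<le> t"
  shows "t *\<^sub>R rank_one x \<preceq> two_level a b y \<longleftrightarrow>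
    t * ((1 - (cmod (cinner x y))\<^sup>2) / a + (cmod (cinner x y))\<^sup>2 / (a + b)) \<le> 1"
proof -
  let ?p = "(cmod (cinner x y))\<^sup>2" and ?T = "two_level a b y"
  define c where "c = cinner x y"
  define u where "u = (1 / a) *\<^sub>R (x - c *\<^sub>C y) + (1 / (a + b)) *\<^sub>R c *\<^sub>C y"
  have orth: "cinner (x - c *\<^sub>C y) y = 0"
    using assms(2) by (simp add: c_def cinner_expand cinner_unit)
  have uy: "cinner u y = of_real (1 / (a + b)) * c"
    using orth assms(2)
    by (simp only: u_def cinner_add_left cinner_scaleR_left cinner_scaleC_left cinner_unit) simp
  have "?T u = a *\<^sub>R u + b *\<^sub>R (of_real (1 / (a + b)) * c) *\<^sub>C y"
    by (simp add: two_level_def blinfun.add_left blinfun.scaleR_left uy)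
  also have "\<dots> = (x - c *\<^sub>C y) + (a / (a + b)) *\<^sub>R c *\<^sub>C y + (b / (a + b)) *\<^sub>R c *\<^sub>C y"
  proof -
    have "(of_real (1 / (a + b)) * c) *\<^sub>C y = (1 / (a + b)) *\<^sub>R c *\<^sub>C y"
      by (simp only: scaleC_scaleC[symmetric] scaleC_of_real)
    then show ?thesis using assms(3) by (simp add: u_def scaleR_add_right)
  qed
  also have "\<dots> = x"
    using assms(4) by (simp add: add.assoc scaleR_add_left[symmetric] add_divide_distrib[symmetric])
  finally have Tu: "?T u = x" .
  have zero: "u - cinner u y *\<^sub>C y = (1 / a) *\<^sub>R (x - c *\<^sub>C y)"
    by (simp only: uy scaleC_scaleC[symmetric] scaleC_of_real) (simp add: u_def)
  have "inner (x - c *\<^sub>C y) (x - c *\<^sub>C y) = 1 - ?p"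
    using inner_decompose[OF assms(2), of x] assms(1) power2_norm_eq_inner[of x] by (simp add: c_def)
  then have "inner (?T u) u = (a + b) * (cmod (of_real (1 / (a + b)) * c))\<^sup>2 + a * ((1 / a) * ((1 / a) * (1 - ?p)))"
    unfolding inner_two_level_decompose[OF assms(2)] unfolding zero
    by (simp only: uy inner_scaleR_left inner_scaleR_right)
  also have "\<dots> = (1 - ?p) / a + ?p / (a + b)"
    using assms(3,4) by (simp add: norm_mult norm_divide power_mult_distrib power_divide power2_eq_square c_def
      flip: of_real_add)
  finally have q: "inner (?T u) u = (1 - ?p) / a + ?p / (a + b)" .
  have p: "0 \<le> ?p" "?p \<le> 1"
    using cmod_cinner_le_unit[OF assms(2), of x] assms(1) power2_norm_eq_inner[of x] by simp_all
  have pos: "0 < (1 - ?p) / a + ?p / (a + b)"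
  proof (cases "?p = 0")
    case False
    then have "0 < ?p / (a + b)" using p assms(4) by simp
    moreover have "0 \<le> (1 - ?p) / a" using p assms(3) by simp
    ultimately show ?thesis by linarith
  qed (use assms(3) in simp)
  show ?thesis
    using scaled_rank_one_le_iff[OF positive_two_level[OF assms(2)], of a b u t] assms(3-5) pos
    unfolding q unfolding Tu by simp
qed

text \<open>
  An effect above the projection fixes its range, so being above \<open>s I\<close> as well is a
  condition on the orthogonal complement only.
\<close>

lemma two_level_le_if_upper_bound:
  assumes "E \<in> effects" "norm y = 1" "s *\<^sub>R id_blinfun \<preceq> E" "rank_one y \<preceq> E"
  shows "two_level s (1 - s) y \<preceq> E"
proof -
  have herm: "hermitian E" using assms(1) by (rule effects_hermitian)
  have "inner (rank_one y y) y \<le> inner (E y) y"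
    using assms(4) by (simp only: op_le_iff[OF hermitian_rank_one herm])
  then have "1 \<le> inner (E y) y" using assms(2) by (simp only: inner_rank_one) (simp add: cinner_unit)
  then have fix_y: "E y = y" using effect_fixes[OF assms(1)] assms(2) by blast
  have "inner (two_level s (1 - s) y z) z \<le> inner (E z) z" for z
  proof -
    define w where "w = z - cinner z y *\<^sub>C y"
    have wy: "cinner w y = 0" using assms(2) by (simp add: w_def cinner_expand cinner_unit)
    then have yw: "cinner y w = 0" using cinner_commute[of y w] by simp
    have Ewy: "cinner (E w) y = 0" by (simp only: hermitian_cinner[OF herm] fix_y wy)
    have z: "z = w + cinner z y *\<^sub>C y" by (simp add: w_def)
    have Ez: "E z = E w + cinner z y *\<^sub>C y"
      by (subst z) (simp only: blinfun.add_right hermitian_scaleC[OF herm] fix_y)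
    have "cinner (E z) z = cinner (E w + cinner z y *\<^sub>C y) (w + cinner z y *\<^sub>C y)"
      by (simp only: Ez z[symmetric])
    also have "\<dots> = cinner (E w) w + cinner z y * cnj (cinner z y)"
      using assms(2) by (simp add: cinner_add_left cinner_add_right cinner_scaleC_left
          cinner_scaleC_right Ewy yw cinner_unit)
    finally have Ezz: "inner (E z) z = inner (E w) w + (cmod (cinner z y))\<^sup>2"
      by (simp only: inner_eq_Re_cinner complex_norm_square[symmetric]) simp
    have "inner ((s *\<^sub>R id_blinfun) w) w \<le> inner (E w) w"
      using assms(3) by (simp only: op_le_iff[OF hermitian_scaleR[OF hermitian_id] herm])
    then show ?thesis
      unfolding Ezz inner_two_level_decompose[OF assms(2)] w_def[symmetric]
      by (simp add: blinfun.scaleR_left)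
  qed
  then show ?thesis unfolding op_le_iff[OF hermitian_two_level herm] by blast
qed

lemma scalar_le_two_level: "s \<le> 1 \<Longrightarrow> s *\<^sub>R id_blinfun \<preceq> two_level s (1 - s) y"
  unfolding op_le_iff[OF hermitian_scaleR[OF hermitian_id] hermitian_two_level] inner_two_level
  by (simp add: blinfun.scaleR_left)

lemma rank_one_le_two_level: "norm y = 1 \<Longrightarrow> 0 \<le> s \<Longrightarrow> rank_one y \<preceq> two_level s (1 - s) y"
  unfolding op_le_iff[OF hermitian_rank_one hermitian_two_level] inner_rank_one
  by (simp add: inner_two_level_decompose)

text \<open>
  Multiples of distinct rank-one projections have no nonzero common lower bound, so the common part
  \<open>C\<close> vanishes and they coexist only if their sum is an effect. That is the order relation
  \<open>t P\<^sub>x \<preceq> I - s P\<^sub>y\<close>, which \<open>scaled_le_two_level_iff\<close> evaluates.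
\<close>

lemma coexistent_scaled_iff:
  assumes "norm x = 1" "norm y = 1" "cmod (cinner x y) \<noteq> 1" "0 < t" "t < 1" "0 < s" "s < 1"
  shows "coexistent (t *\<^sub>R rank_one x) (s *\<^sub>R rank_one y) \<longleftrightarrow>
    t * s * (cmod (cinner x y))\<^sup>2 \<le> (1 - t) * (1 - s)"
proof -
  let ?p = "(cmod (cinner x y))\<^sup>2"
  have sum: "coexistent (t *\<^sub>R rank_one x) (s *\<^sub>R rank_one y) \<longleftrightarrow>
      t *\<^sub>R rank_one x + s *\<^sub>R rank_one y \<in> effects" (is "?l \<longleftrightarrow> ?r")
  proof
    assume ?l
    then obtain A B C where ABC: "A \<in> effects" "B \<in> effects" "C \<in> effects" "t *\<^sub>R rank_one x = A + C"
      "s *\<^sub>R rank_one y = B + C" "A + B + C \<in> effects"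
      unfolding coexistent_def by blast
    have herm: "hermitian C" using ABC(3) by (rule effects_hermitian)
    have "inner (C z) z \<le> inner ((t *\<^sub>R rank_one x) z) z" for z
      unfolding ABC(4) using ABC(1) by (simp add: effects_iff blinfun.add_left inner_add_left)
    then have Cx: "C \<preceq> t *\<^sub>R rank_one x" unfolding op_le_iff[OF herm hermitian_scaled] by blast
    have "inner (C z) z \<le> inner ((s *\<^sub>R rank_one y) z) z" for z
      unfolding ABC(5) using ABC(2) by (simp add: effects_iff blinfun.add_left inner_add_left)
    then have Cy: "C \<preceq> s *\<^sub>R rank_one y" unfolding op_le_iff[OF herm hermitian_scaled] by blast
    obtain r where r: "0 \<le> r" "r \<le> 1" "C = r *\<^sub>R rank_one x"
      using below_rank_one[OF ABC(3) Cx assms(1)] by blast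
    have "r = 0"
      using scaled_le_imp_parallel(1)[OF assms(1,2), of r s] Cy r assms(3,6,7) by force
    then have "C = 0" using r by simp
    then show ?r using ABC(4-6) by simp
  next
    assume ?r
    moreover have "0 \<in> (effects :: ('a \<Rightarrow>\<^sub>L 'a) set)" by (simp add: effects_iff hermitian_0)
    ultimately show ?l
      unfolding coexistent_def
      using scaled_effect[OF assms(1), of t] scaled_effect[OF assms(2), of s] assms(4-7)
      by (intro bexI[of _ "t *\<^sub>R rank_one x"] bexI[of _ "s *\<^sub>R rank_one y"] bexI[of _ 0]) auto
  qed
  have "t *\<^sub>R rank_one x + s *\<^sub>R rank_one y \<in> effects \<longleftrightarrow> t *\<^sub>R rank_one x \<preceq> two_level 1 (- s) y"
  proof -
    have herm: "hermitian (t *\<^sub>R rank_one x + s *\<^sub>R rank_one y)"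
      by (intro hermitian_add hermitian_scaled)
    have 1: "inner ((t *\<^sub>R rank_one x + s *\<^sub>R rank_one y) z) z = t * (cmod (cinner z x))\<^sup>2 + s * (cmod (cinner z y))\<^sup>2" for z
      by (simp only: blinfun.add_left inner_add_left inner_scaled)
    have 2: "0 \<le> t * (cmod (cinner z x))\<^sup>2 + s * (cmod (cinner z y))\<^sup>2" for z
      using assms(4,6) by simp
    show ?thesis
      unfolding effects_iff 1 op_le_iff[OF hermitian_scaled hermitian_two_level] inner_two_level inner_scaled
      using herm 2 by (simp add: algebra_simps)
  qed
  also have "\<dots> \<longleftrightarrow> t * ((1 - ?p) / 1 + ?p / (1 + - s)) \<le> 1"
    by (rule scaled_le_two_level_iff) (use assms in simp_all)
  also have "\<dots> \<longleftrightarrow> t * s * ?p \<le> (1 - t) * (1 - s)"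
    using assms(7) by (simp add: field_simps)
  finally show ?thesis using sum by simp
qed

section \<open>A functional equation\<close>

text \<open>
  Additivity fixes \<open>F\<close> on the positive integers, and monotonicity traps \<open>n F x = F (n x)\<close> between
  consecutive integers around \<open>n x\<close> for every \<open>n\<close>.
\<close>

lemma additive_mono_imp_identity:
  fixes F :: "real \<Rightarrow> real"
  assumes pos: "\<And>x. 0 < x \<Longrightarrow> 0 < F x"
    and mono: "\<And>x y. 0 < x \<Longrightarrow> x \<le> y \<Longrightarrow> F x \<le> F y"
    and add: "\<And>x y. 0 < x \<Longrightarrow> 0 < y \<Longrightarrow> F (x + y) = F x + F y"
    and one: "F 1 = 1" and x: "0 < x"
  shows "F x = x"
proof (rule ccontr)
  have mult: "F (real (Suc n) * y) = real (Suc n) * F y" if "0 < y" for n y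
  proof (induction n)
    case (Suc n)
    have "F (real (Suc n) * y + y) = F (real (Suc n) * y) + F y" using that by (intro add) simp_all
    then show ?case using Suc by (simp add: algebra_simps)
  qed simp
  have nat: "F (real n) = real n" if "0 < n" for n
    using mult[of 1 "n - 1"] one that by simp
  assume "F x \<noteq> x"
  then have "0 < \<bar>F x - x\<bar>" by simp
  then obtain n where n: "1 < real n * \<bar>F x - x\<bar>" using reals_Archimedean3 by blast
  then have "0 < n" by (cases n) simp_all
  then have nF: "F (real n * x) = real n * F x" using mult[OF x, of "n - 1"] by simp
  define m where "m = nat \<lfloor>real n * x\<rfloor>"
  have nx: "0 < real n * x" using x \<open>0 < n\<close> by simp
  then have m: "real m \<le> real n * x" "real n * x \<le> real (Suc m)"
    unfolding m_def by (simp, use nx in simp, linarith)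
  have "real m \<le> real n * F x"
  proof (cases "m = 0")
    case True
    then show ?thesis using pos[OF x] by simp
  next
    case False
    then show ?thesis using mono[OF _ m(1)] nat[of m] nF by simp
  qed
  moreover have "real n * F x \<le> real (Suc m)" using mono[OF nx m(2)] nat[of "Suc m"] nF by simp
  ultimately have "\<bar>real n * F x - real n * x\<bar> \<le> 1" using m by simp
  then show False using n by (simp add: abs_mult flip: right_diff_distrib)
qed

text \<open>
  Since \<open>F\<close> is an order isomorphism, the equivalences are the equations
  \<open>F ((1 - p) w) = (1 - p') F w\<close> and \<open>F w F (p / w) = p'\<close>. With \<open>d = F 1\<close>, eliminating \<open>p'\<close> gives
  \<open>F (1 - p) = d - d\<^sup>2 F p\<close>. The symmetry \<open>p \<mapsto> 1 - p\<close> forces \<open>d = 1\<close>, so \<open>F\<close> is multiplicative with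
  \<open>F p + F (1 - p) = 1\<close>, and these two properties together make it additive.
\<close>

lemma scale_rigidity:
  fixes F :: "real \<Rightarrow> real"
  assumes bij: "bij_betw F {0<..} {0<..}"
    and mono: "\<And>v w. 0 < v \<Longrightarrow> 0 < w \<Longrightarrow> F v \<le> F w \<longleftrightarrow> v \<le> w"
    and ex: "\<And>p. 0 < p \<Longrightarrow> p < 1 \<Longrightarrow> \<exists>p'<1.
      (\<forall>v>0. \<forall>w>0. (1 - p) * w \<le> v \<longleftrightarrow> (1 - p') * F w \<le> F v) \<and>
      (\<forall>v>0. \<forall>w>0. p \<le> v * w \<longleftrightarrow> p' \<le> F v * F w)"
    and x: "0 < x"
  shows "F x = x"
proof -
  have pos: "0 < F w" if "0 < w" for w using bij_betwE[OF bij] that by auto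
  have eqI: "F a = y" if "0 < a" "0 < y" "\<And>v. 0 < v \<Longrightarrow> a \<le> v \<longleftrightarrow> y \<le> F v" for a y
  proof -
    have "y \<in> F ` {0<..}" using bij that(2) by (simp add: bij_betw_def)
    then obtain b where b: "0 < b" "F b = y" by auto
    have "a \<le> b" using that(3)[OF b(1)] b(2) by simp
    moreover have "b \<le> a" using that(3)[OF that(1)] b mono[OF b(1) that(1)] by simp
    ultimately show ?thesis using b(2) by simp
  qed
  define d where "d = F 1"
  have d: "0 < d" by (simp add: d_def pos)
  have key: "\<exists>p'. (\<forall>w>0. F ((1 - p) * w) = (1 - p') * F w) \<and> p' = d * F p" if p: "0 < p" "p < 1" for p
  proof -
    obtain p' where p': "p' < 1" "\<And>v w. 0 < v \<Longrightarrow> 0 < w \<Longrightarrow> (1 - p) * w \<le> v \<longleftrightarrow> (1 - p') * F w \<le> F v"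
      "\<And>v w. 0 < v \<Longrightarrow> 0 < w \<Longrightarrow> p \<le> v * w \<longleftrightarrow> p' \<le> F v * F w"
      using ex[OF p] by blast
    have "F ((1 - p) * w) = (1 - p') * F w" if "0 < w" for w
    proof (rule eqI)
      show "0 < (1 - p) * w" using p(2) that by simp
      show "0 < (1 - p') * F w" using p'(1) pos[OF that] by simp
    qed (rule p'(2)[OF _ that])
    moreover have "F p = p' / d"
    proof (rule eqI)
      show "0 < p' / d"
      proof (rule ccontr)
        assume "\<not> 0 < p' / d"
        then have "p' \<le> 0" using d by (simp add: zero_less_divide_iff)
        moreover have "0 < F (p / 2) * F 1" using pos[of "p / 2"] pos[of 1] p(1) by simp
        ultimately have "p' \<le> F (p / 2) * F 1" by linarith
        then show False using p'(3)[of "p / 2" 1] p by simp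
      qed
      show "p \<le> v \<longleftrightarrow> p' / d \<le> F v" if "0 < v" for v
        using p'(3)[OF that, of 1] d by (simp add: d_def pos_divide_le_eq)
    qed (use p in simp)
    ultimately show ?thesis using d by (intro exI[of _ p']) simp
  qed
  have scale: "F ((1 - p) * w) = (1 - d * F p) * F w" if "0 < p" "p < 1" "0 < w" for p w
    using key[OF that(1,2)] that(3) by blast
  have refl: "F (1 - p) = (1 - d * F p) * d" if "0 < p" "p < 1" for p
    using scale[OF that, of 1] by (simp add: d_def)
  have "d = 1"
  proof -
    \<comment> \<open>\<open>1/3\<close> and \<open>2/3\<close> stand for any two distinct points exchanged by \<open>q \<mapsto> 1 - q\<close>.\<close>
    have "F (2/3) = (1 - d * F (1/3)) * d" using refl[of "1/3"] by simp
    moreover have "F (1/3) = (1 - d * F (2/3)) * d" using refl[of "2/3"] by simp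
    ultimately have "(d * d - 1) * (F (2/3) - F (1/3)) = 0" by argo
    moreover have "F (2/3) \<noteq> F (1/3)" using mono[of "2/3" "1/3"] by auto
    ultimately have "d * d = 1 * 1" by simp
    then show ?thesis using d by (metis power2_eq_square power2_eq_imp_eq less_imp_le zero_le_one)
  qed
  have mult: "F (q * w) = F q * F w" if "0 < q" "q < 1" "0 < w" for q w
    using scale[of "1 - q" w] refl[of "1 - q"] that by (simp add: \<open>d = 1\<close>)
  show ?thesis
  proof (rule additive_mono_imp_identity[OF pos])
    fix a b :: real assume ab: "0 < a" "0 < b"
    define q where "q = a / (a + b)"
    have q: "0 < q" "q < 1" "q * (a + b) = a" "(1 - q) * (a + b) = b"
      using ab by (simp_all add: q_def field_simps)
    have "F a + F b = F q * F (a + b) + F (1 - q) * F (a + b)"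
      using mult[OF q(1,2), of "a + b"] mult[of "1 - q" "a + b"] q ab by simp
    also have "\<dots> = (F q + F (1 - q)) * F (a + b)" by (simp add: distrib_right)
    also have "F q + F (1 - q) = 1" using refl[OF q(1,2)] by (simp add: \<open>d = 1\<close>)
    finally show "F (a + b) = F a + F b" by simp
  qed (use x mono \<open>d = 1\<close> d_def in auto)
qed

text \<open>
  The same in the coordinate \<open>s = 1 / (1 + w)\<close> on the unit interval, in which the
  order and coexistence relations of effects appear.
\<close>

lemma unit_interval_rigidity:
  fixes f :: "real \<Rightarrow> real"
  assumes bij: "bij_betw f {0..1} {0..1}"
    and mono: "\<And>s t. s \<in> {0..1} \<Longrightarrow> t \<in> {0..1} \<Longrightarrow> f s \<le> f t \<longleftrightarrow> s \<le> t"
    and ex: "\<And>p. 0 < p \<Longrightarrow> p < 1 \<Longrightarrow> \<exists>p'<1.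
      (\<forall>s\<in>{0<..<1}. \<forall>t\<in>{0<..<1}. t * ((1 - p) / s + p) \<le> 1 \<longleftrightarrow> f t * ((1 - p') / f s + p') \<le> 1) \<and>
      (\<forall>s\<in>{0<..<1}. \<forall>t\<in>{0<..<1}. t * s * p \<le> (1 - t) * (1 - s) \<longleftrightarrow> f t * f s * p' \<le> (1 - f t) * (1 - f s))"
    and t: "t \<in> {0..1}"
  shows "f t = t"
proof -
  have onto: "\<exists>s\<in>{0..1}. f s = r" if "r \<in> {0..1}" for r
    using bij that unfolding bij_betw_def by (metis imageE)
  have into: "f s \<in> {0..1}" if "s \<in> {0..1}" for s
    using bij that by (rule bij_betwE[THEN bspec])
  have f0: "f 0 = 0"
  proof -
    obtain s where s: "s \<in> {0..1}" "f s = 0" using onto[of 0] by auto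
    then have "f 0 \<le> 0" using mono[of 0 s] by simp
    then show ?thesis using into[of 0] by simp
  qed
  have f1: "f 1 = 1"
  proof -
    obtain s where s: "s \<in> {0..1}" "f s = 1" using onto[of 1] by auto
    then have "1 \<le> f 1" using mono[of s 1] by simp
    then show ?thesis using into[of 1] by simp
  qed
  have open_iff: "f s \<in> {0<..<1} \<longleftrightarrow> s \<in> {0<..<1}" if "s \<in> {0..1}" for s
    using mono[of s 0] mono[of 1 s] that f0 f1 by (auto simp: not_le[symmetric])
  define h where "h w = 1 / (1 + w)" for w :: real
  have h: "h w \<in> {0<..<1}" if "0 < w" for w using that by (simp add: h_def)
  have h_inv: "h (1 / s - 1) = s" "0 < 1 / s - 1" if "s \<in> {0<..<1}" for s
    using that by (simp_all add: h_def)
  have h_mono: "h v \<le> h w \<longleftrightarrow> w \<le> v" if "0 < v" "0 < w" for v w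
    using that by (simp add: h_def field_simps)
  define F where "F w = 1 / f (h w) - 1" for w
  have fh: "f (h w) \<in> {0<..<1}" if "0 < w" for w
    using open_iff[of "h w"] h[OF that] by simp
  have hF: "f (h w) = h (F w)" and F: "0 < F w" if "0 < w" for w
    using h_inv[OF fh[OF that]] by (simp_all add: F_def)
  have lin: "h v * ((1 - p) / h w + p) \<le> 1 \<longleftrightarrow> (1 - p) * w \<le> v" if "0 < v" "0 < w" for v w p
    using that by (simp add: h_def field_simps)
  have prod: "h v * h w * p \<le> (1 - h v) * (1 - h w) \<longleftrightarrow> p \<le> v * w" if "0 < v" "0 < w" for v w p
  proof -
    have "(1 - h v) * (1 - h w) = h v * h w * (v * w)" using that by (simp add: h_def field_simps)
    then show ?thesis using h[OF that(1)] h[OF that(2)] by simp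
  qed
  have F_id: "F w = w" if "0 < w" for w
  proof (rule scale_rigidity[OF _ _ _ that])
    have "inj_on F {0<..}"
    proof (rule inj_onI)
      fix v w :: real assume vw: "v \<in> {0<..}" "w \<in> {0<..}" "F v = F w"
      then have "f (h v) = f (h w)" by (simp add: hF)
      then have "h v = h w" using mono[of "h v" "h w"] mono[of "h w" "h v"] h[of v] h[of w] vw by simp
      then show "v = w" using h_mono[of v w] h_mono[of w v] vw by simp
    qed
    moreover have "y \<in> F ` {0<..}" if y: "0 < y" for y
    proof -
      obtain s where s: "s \<in> {0..1}" "f s = h y" using onto[of "h y"] h[OF y] by auto
      then have "s \<in> {0<..<1}" using open_iff[of s] h[OF y] by simp
      from h_inv[OF this] have "F (1 / s - 1) = y" "0 < 1 / s - 1"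
        using s(2) y by (simp_all add: F_def h_def)
      then show ?thesis by force
    qed
    ultimately show "bij_betw F {0<..} {0<..}" using F by (auto simp: bij_betw_def)
    show "F v \<le> F w \<longleftrightarrow> v \<le> w" if "0 < v" "0 < w" for v w
      using h_mono[OF F F, of w v] h_mono[of w v] mono[of "h w" "h v"] h[of v] h[of w] that
      by (simp add: hF[symmetric])
    fix p :: real assume "0 < p" "p < 1"
    from ex[OF this] obtain p' where p': "p' < 1"
      "\<forall>s\<in>{0<..<1}. \<forall>t\<in>{0<..<1}.
        t * ((1 - p) / s + p) \<le> 1 \<longleftrightarrow> f t * ((1 - p') / f s + p') \<le> 1"
      "\<forall>s\<in>{0<..<1}. \<forall>t\<in>{0<..<1}.
        t * s * p \<le> (1 - t) * (1 - s) \<longleftrightarrow> f t * f s * p' \<le> (1 - f t) * (1 - f s)"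
      by (elim exE conjE)
    have "(1 - p) * w \<le> v \<longleftrightarrow> (1 - p') * F w \<le> F v" if "0 < v" "0 < w" for v w
      using p'(2)[rule_format, OF h[OF that(2)] h[OF that(1)]]
      unfolding hF[OF that(1)] hF[OF that(2)] lin[OF that] lin[OF F[OF that(1)] F[OF that(2)]] .
    moreover have "p \<le> v * w \<longleftrightarrow> p' \<le> F v * F w" if "0 < v" "0 < w" for v w
      using p'(3)[rule_format, OF h[OF that(2)] h[OF that(1)]]
      unfolding hF[OF that(1)] hF[OF that(2)] prod[OF that] prod[OF F[OF that(1)] F[OF that(2)]] .
    ultimately show "\<exists>p'<1.
      (\<forall>v>0. \<forall>w>0. (1 - p) * w \<le> v \<longleftrightarrow> (1 - p') * F w \<le> F v) \<and>
      (\<forall>v>0. \<forall>w>0. p \<le> v * w \<longleftrightarrow> p' \<le> F v * F w)"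
      using p'(1) by (intro exI[of _ p'] conjI allI impI) blast+
  qed
  show ?thesis
  proof (cases "t \<in> {0<..<1}")
    case True
    from h_inv[OF this] show ?thesis using F_id hF by metis
  next
    case False
    then show ?thesis using t f0 f1 by force
  qed
qed

section \<open>Wigner's theorem\<close>

lemma unit_multiple_if_cmod_cinner_eq:
  assumes "norm x = norm (y::'a::complex_inner)" "cmod (cinner x y) = (norm y)\<^sup>2"
  shows "\<exists>c. cmod c = 1 \<and> x = c *\<^sub>C y"
proof (cases "y = 0")
  case True
  then show ?thesis using assms(1) by (intro exI[of _ 1]) simp
next
  case False
  let ?u = "y /\<^sub>R norm y"
  have u: "norm ?u = 1" using False by simp
  have "cmod (cinner x ?u) = norm x"
    using False assms by (simp add: cinner_scaleR_right norm_mult norm_inverse power2_eq_square)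
  then have x: "x = cinner x ?u *\<^sub>C ?u" by (rule parallel_if_cmod_cinner_eq[OF u])
  define c where "c = cinner x ?u * of_real (inverse (norm y))"
  have "cinner x ?u *\<^sub>C ?u = c *\<^sub>C y"
    by (simp only: c_def scaleC_scaleC[symmetric] scaleC_of_real)
  then have xc: "x = c *\<^sub>C y" using x by (rule trans[rotated])
  then have "cmod c = 1" using assms(1) False by simp
  then show ?thesis using xc by blast
qed

lemma norm_square_add_one: "(cmod (1 + a))\<^sup>2 = 1 + 2 * Re a + (cmod a)\<^sup>2"
  by (simp only: cmod_power2) (simp add: power2_eq_square algebra_simps)

lemma scaleC_decompose: "c *\<^sub>C x = Re c *\<^sub>R x + Im c *\<^sub>R \<i> *\<^sub>C (x::'a::complex_vector)"
proof -
  have "c *\<^sub>C x = (of_real (Re c) + of_real (Im c) * \<i>) *\<^sub>C x"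
    by (simp add: complex_eq[of c, symmetric] mult.commute)
  then show ?thesis by (simp only: scaleC_add_left scaleC_scaleC[symmetric] scaleC_of_real)
qed

text \<open>
  A map preserving the moduli of inner products is only determined up to a phase at each vector.
  Fixing the phases on the affine hyperplane \<open>e + e\<^sup>\<bottom>\<close> by the requirement that the component along
  \<open>T e\<close> be \<open>1\<close> gives a map \<open>V\<close> on \<open>e\<^sup>\<bottom>\<close>. Comparing \<open>\<bar>1 + \<langle>y,z\<rangle>\<bar>\<close> with \<open>\<bar>\<langle>y,z\<rangle>\<bar>\<close> shows that \<open>V\<close>
  preserves real parts of inner products; it is therefore real-linear, and the
  rest is to see that it either commutes or anticommutes with \<open>\<i>\<close>.
\<close>

theorem wigner:
  fixes T :: "'a::complex_hilbert \<Rightarrow> 'a" and e :: 'a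
  assumes pres: "\<And>x y. cmod (cinner (T x) (T y)) = cmod (cinner x y)"
    and surj: "\<And>z. \<exists>x c. z = c *\<^sub>C T x"
    and e: "norm e = 1"
  obtains U where "unitary_op U \<or> antiunitary_op U" "\<And>x. \<exists>c. cmod c = 1 \<and> U x = c *\<^sub>C T x"
proof -
  have normT: "norm (T x) = norm x" for x
  proof -
    have "(norm (T x))\<^sup>2 = (norm x)\<^sup>2" using pres[of x x] by (simp add: cinner_self norm_power)
    then show ?thesis by (simp add: power2_eq_iff_nonneg)
  qed
  define f where "f = T e"
  have f: "norm f = 1" using e by (simp add: f_def normT)
  have ee: "cinner e e = 1" and ff: "cinner f f = 1" using e f by (simp_all add: cinner_self)
  define ph where "ph y = cinner (T (e + y)) f" for y
  define V where "V y = (1 / ph y) *\<^sub>C T (e + y) - f" for y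
  define M where "M y \<longleftrightarrow> cinner y e = 0" for y
  have M': "cinner e y = 0" if "M y" for y
    using that cinner_commute[of e y] by (simp add: M_def)
  have M_comb: "M (a *\<^sub>C y + b *\<^sub>C z)" if "M y" "M z" for a b y z
    using that by (simp add: M_def cinner_expand)
  have M_add: "M (y + z)" and M_scale: "M (a *\<^sub>C y)" if "M y" "M z" for a y z
    using that by (simp_all add: M_def cinner_expand)
  have ph: "cmod (ph y) = 1" if "M y" for y
    using pres[of "e + y" e] that ee by (simp add: ph_def f_def M_def cinner_add_left)
  have TV: "T (e + y) = ph y *\<^sub>C (f + V y)" if "M y" for y
    using ph[OF that] by (auto simp: V_def scaleC_scaleC)
  have Vf: "cinner (V y) f = 0" if "M y" for y
    using ph[OF that] by (auto simp: V_def cinner_expand ff ph_def[symmetric])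
  have fV: "cinner f (V y) = 0" if "M y" for y
    using Vf[OF that] cinner_commute[of f "V y"] by simp
  have V_affine: "cmod (1 + cinner (V y) (V z)) = cmod (1 + cinner y z)" if "M y" "M z" for y z
  proof -
    have "cinner (T (e + y)) (T (e + z)) = (ph y * cnj (ph z)) * (1 + cinner (V y) (V z))"
      using that
      by (simp add: TV cinner_add_left cinner_add_right cinner_scaleC_left cinner_scaleC_right ff fV Vf
          distrib_left)
    then have "cmod (cinner (T (e + y)) (T (e + z))) = cmod (1 + cinner (V y) (V z))"
      using that by (simp add: norm_mult ph)
    moreover have "cinner (e + y) (e + z) = 1 + cinner y z"
      using that M'[OF that(2)] by (simp add: cinner_add_left cinner_add_right ee M_def)
    ultimately show ?thesis using pres[of "e + y" "e + z"] by simp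
  qed
  \<comment> \<open>The inner product of \<open>T (e + y)\<close> and \<open>T y\<close> has modulus \<open>\<parallel>y\<parallel>\<^sup>2\<close>, so \<open>V y\<close> already has its full
    norm along \<open>T y\<close>.\<close>
  have V_ray: "\<exists>c. cmod c = 1 \<and> V y = c *\<^sub>C T y" if "M y" for y
  proof (rule unit_multiple_if_cmod_cinner_eq)
    have 1: "cmod (1 + of_real ((norm (V y))\<^sup>2)) = cmod (1 + of_real ((norm y)\<^sup>2))"
      using V_affine[OF that that] by (simp add: cinner_self)
    have 2: "cmod (1 + of_real (r\<^sup>2)) = 1 + r\<^sup>2" for r :: real
    proof -
      have "1 + of_real (r\<^sup>2) = complex_of_real (1 + r\<^sup>2)" by simp
      then show ?thesis by (simp only: norm_of_real) simp
    qed
    have "(norm (V y))\<^sup>2 = (norm y)\<^sup>2" using 1 unfolding 2 by simp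
    then have n: "norm (V y) = norm y" by (simp add: power2_eq_iff_nonneg)
    then show "norm (V y) = norm (T y)" by (simp add: normT)
    have "cmod (cinner f (T y)) = 0" using M'[OF that] by (simp add: f_def pres)
    then have fT: "cinner f (T y) = 0" by simp
    have "cmod (cinner (V y) (T y)) = cmod (cinner (T (e + y)) (T y))"
      using that by (simp add: TV cinner_add_left cinner_scaleC_left fT norm_mult ph)
    also have "\<dots> = cmod (cinner y y)" using M'[OF that] by (simp add: pres cinner_add_left)
    finally show "cmod (cinner (V y) (T y)) = (norm (T y))\<^sup>2"
      by (simp add: cinner_self normT norm_power)
  qed
  have V_cmod: "cmod (cinner (V y) (V z)) = cmod (cinner y z)" if "M y" "M z" for y z
  proof -
    obtain b where b: "cmod b = 1" "V y = b *\<^sub>C T y" using V_ray[OF \<open>M y\<close>] by blast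
    obtain c where c: "cmod c = 1" "V z = c *\<^sub>C T z" using V_ray[OF \<open>M z\<close>] by blast
    show ?thesis using b(1) c(1)
      by (simp add: b(2) c(2) cinner_scaleC_left cinner_scaleC_right norm_mult pres)
  qed
  have V_inner: "inner (V y) (V z) = inner y z" if "M y" "M z" for y z
  proof -
    have "(cmod (1 + cinner (V y) (V z)))\<^sup>2 = (cmod (1 + cinner y z))\<^sup>2"
      by (simp only: V_affine[OF that])
    then show ?thesis
      unfolding norm_square_add_one V_cmod[OF that] by (simp add: inner_eq_Re_cinner)
  qed
  have V_comb: "V (r *\<^sub>R y + s *\<^sub>R z) = r *\<^sub>R V y + s *\<^sub>R V z" if "M y" "M z" for r s y z
  proof -
    let ?w = "r *\<^sub>R y + s *\<^sub>R z"
    have w: "M ?w" using M_comb[OF that, of "of_real r" "of_real s"] by (simp only: scaleC_of_real)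
    have "inner (V ?w - (r *\<^sub>R V y + s *\<^sub>R V z)) (V ?w - (r *\<^sub>R V y + s *\<^sub>R V z))
        = inner (?w - (r *\<^sub>R y + s *\<^sub>R z)) (?w - (r *\<^sub>R y + s *\<^sub>R z))"
      by (simp only: inner_diff_left inner_diff_right inner_add_left inner_add_right
          inner_scaleR_left inner_scaleR_right V_inner[OF w w] V_inner[OF w that(1)]
          V_inner[OF w that(2)] V_inner[OF that(1) w] V_inner[OF that(2) w]
          V_inner[OF that] V_inner[OF that(2,1)] V_inner[OF that(1,1)] V_inner[OF that(2,2)])
        (simp add: algebra_simps inner_commute[of z y])
    then show ?thesis by simp
  qed
  have V_add: "V (y + z) = V y + V z" if "M y" "M z" for y z
    using V_comb[OF that, of 1 1] by simp
  have V_i: "V (\<i> *\<^sub>C y) = \<i> *\<^sub>C V y \<or> V (\<i> *\<^sub>C y) = (- \<i>) *\<^sub>C V y" if "M y" for y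
  proof (cases "y = 0")
    case True
    then have "V y = 0" using V_comb[OF that that, of 0 0] by simp
    then show ?thesis using True by simp
  next
    case False
    have iy: "M (\<i> *\<^sub>C y)" by (rule M_scale[OF that that])
    have nV: "norm (V w) = norm w" if "M w" for w
      using V_inner[OF that that] by (simp add: norm_eq_sqrt_inner)
    have "\<exists>c. cmod c = 1 \<and> V (\<i> *\<^sub>C y) = c *\<^sub>C V y"
      by (rule unit_multiple_if_cmod_cinner_eq)
        (simp_all add: nV[OF iy] nV[OF that] V_cmod[OF iy that] cinner_scaleC_left cinner_self
          norm_mult norm_power)
    then obtain c where c: "cmod c = 1" "V (\<i> *\<^sub>C y) = c *\<^sub>C V y" by blast
    have "inner (V (\<i> *\<^sub>C y)) (V y) = Re c * (norm y)\<^sup>2"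
      by (simp add: c(2) inner_eq_Re_cinner cinner_scaleC_left cinner_self nV[OF that] flip: of_real_power)
    moreover have "inner (V (\<i> *\<^sub>C y)) (V y) = 0"
      unfolding V_inner[OF iy that]
      by (simp add: inner_eq_Re_cinner cinner_scaleC_left cinner_self flip: of_real_power)
    ultimately have "Re c = 0" using False by simp
    moreover have "(Re c)\<^sup>2 + (Im c)\<^sup>2 = 1" using c(1) cmod_power2[of c] by simp
    ultimately have "c = \<i> \<or> c = - \<i>" by (simp add: complex_eq_iff power2_eq_1_iff)
    then show ?thesis using c(2) by auto
  qed
  \<comment> \<open>Nonzero vectors of both kinds cannot occur together: at their sum additivity would force one of the two
    images to vanish.\<close>
  have dichotomy: "(\<forall>y. M y \<longrightarrow> V (\<i> *\<^sub>C y) = \<i> *\<^sub>C V y) \<or> (\<forall>y. M y \<longrightarrow> V (\<i> *\<^sub>C y) = (- \<i>) *\<^sub>C V y)"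
  proof (rule ccontr)
    assume "\<not> ?thesis"
    then obtain y z where y: "M y" "V (\<i> *\<^sub>C y) \<noteq> \<i> *\<^sub>C V y" and z: "M z" "V (\<i> *\<^sub>C z) \<noteq> (- \<i>) *\<^sub>C V z"
      by blast
    have iy: "V (\<i> *\<^sub>C y) = (- \<i>) *\<^sub>C V y" and iz: "V (\<i> *\<^sub>C z) = \<i> *\<^sub>C V z"
      using V_i y z by blast+
    have nonzero: "\<i> *\<^sub>C v \<noteq> (- \<i>) *\<^sub>C v" if "v \<noteq> 0" for v :: 'a
    proof
      assume "\<i> *\<^sub>C v = (- \<i>) *\<^sub>C v"
      then have "(\<i> - (- \<i>)) *\<^sub>C v = 0" unfolding complex_vector.scale_left_diff_distrib by simp
      then show False using that by simp
    qed
    have Vy: "V y \<noteq> 0" and Vz: "V z \<noteq> 0" using y(2) z(2) iy iz by auto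
    have "V (\<i> *\<^sub>C (y + z)) = (- \<i>) *\<^sub>C V y + \<i> *\<^sub>C V z"
      unfolding scaleC_add_right V_add[OF M_scale[OF y(1) y(1)] M_scale[OF z(1) z(1)]] iy iz ..
    with V_i[OF M_add[OF y(1) z(1)]]
    have "(- \<i>) *\<^sub>C V y = \<i> *\<^sub>C V y \<or> \<i> *\<^sub>C V z = (- \<i>) *\<^sub>C V z"
      unfolding V_add[OF y(1) z(1)] scaleC_add_right by (simp only: add_right_cancel add_left_cancel)
    then show False
      using nonzero[OF Vy] nonzero[OF Vz] by metis
  qed
  obtain \<kappa> :: "complex \<Rightarrow> complex" where \<kappa>: "\<kappa> = (\<lambda>c. c) \<or> \<kappa> = cnj"
    and V_scale: "\<And>c y. M y \<Longrightarrow> V (c *\<^sub>C y) = \<kappa> c *\<^sub>C V y"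
  proof -
    have split: "V (c *\<^sub>C y) = Re c *\<^sub>R V y + Im c *\<^sub>R V (\<i> *\<^sub>C y)" if "M y" for c y
      unfolding scaleC_decompose[of c y] by (rule V_comb[OF that M_scale[OF that that]])
    from dichotomy show thesis
    proof
      assume i: "\<forall>y. M y \<longrightarrow> V (\<i> *\<^sub>C y) = \<i> *\<^sub>C V y"
      have "V (c *\<^sub>C y) = c *\<^sub>C V y" if "M y" for c y
        using split[OF that, of c] i that scaleC_decompose[of c "V y"] by simp
      then show thesis by (intro that[of "\<lambda>c. c"]) simp_all
    next
      assume i: "\<forall>y. M y \<longrightarrow> V (\<i> *\<^sub>C y) = (- \<i>) *\<^sub>C V y"
      have "V (c *\<^sub>C y) = cnj c *\<^sub>C V y" if "M y" for c y
        using split[OF that, of c] i that scaleC_decompose[of "cnj c" "V y"] by simp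
      then show thesis by (intro that[of cnj]) simp_all
    qed
  qed
  have \<kappa>_simps: "\<kappa> (a + b) = \<kappa> a + \<kappa> b" "\<kappa> (a * b) = \<kappa> a * \<kappa> b" "cmod (\<kappa> a) = cmod a" "\<kappa> (\<kappa> a) = a" for a b
    using \<kappa> by auto
  define P where "P x = x - cinner x e *\<^sub>C e" for x
  have MP: "M (P x)" for x by (simp add: M_def P_def cinner_expand ee)
  have P_add: "P (x + y) = P x + P y" for x y
    by (simp add: P_def cinner_expand scaleC_add_left)
  have P_scale: "P (c *\<^sub>C x) = c *\<^sub>C P x" for c x
    by (simp add: P_def cinner_expand scaleC_scaleC complex_vector.scale_right_diff_distrib)
  have norm_sum: "(norm (a *\<^sub>C g + w))\<^sup>2 = (cmod a)\<^sup>2 + (norm w)\<^sup>2"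
    if "norm g = 1" "cinner w g = 0" for a and g w :: 'a
  proof -
    have gw: "cinner g w = 0" using that(2) cinner_commute[of g w] by simp
    have "of_real ((norm (a *\<^sub>C g + w))\<^sup>2) = cinner (a *\<^sub>C g + w) (a *\<^sub>C g + w)"
      by (simp only: cinner_self)
    also have "\<dots> = a * cnj a + cinner w w"
      using that gw by (simp add: cinner_add_left cinner_add_right cinner_scaleC_left
          cinner_scaleC_right cinner_self[of g])
    also have "\<dots> = of_real ((cmod a)\<^sup>2 + (norm w)\<^sup>2)"
      by (simp only: of_real_add cinner_self complex_norm_square)
    finally show ?thesis by (simp only: of_real_eq_iff)
  qed
  define U where "U x = \<kappa> (cinner x e) *\<^sub>C f + V (P x)" for x
  have U_add: "U (x + y) = U x + U y" for x y
    by (simp add: U_def P_add V_add MP cinner_add_left \<kappa>_simps scaleC_add_left)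
  have U_scale: "U (c *\<^sub>C x) = \<kappa> c *\<^sub>C U x" for c x
    by (simp add: U_def P_scale V_scale MP cinner_scaleC_left \<kappa>_simps scaleC_add_right scaleC_scaleC)
  have U_norm: "norm (U x) = norm x" for x
  proof -
    have "(norm (U x))\<^sup>2 = (cmod (cinner x e))\<^sup>2 + (norm (V (P x)))\<^sup>2"
      unfolding U_def using norm_sum[OF f Vf[OF MP]] by (simp add: \<kappa>_simps)
    also have "(norm (V (P x)))\<^sup>2 = (norm (P x))\<^sup>2"
      using V_inner[OF MP MP, of x x] by (simp add: power2_norm_eq_inner)
    also have "(cmod (cinner x e))\<^sup>2 + (norm (P x))\<^sup>2 = (norm (cinner x e *\<^sub>C e + P x))\<^sup>2"
      using norm_sum[OF e, of "P x"] MP[of x] by (simp add: M_def)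
    also have "cinner x e *\<^sub>C e + P x = x" by (simp add: P_def)
    finally show ?thesis by (simp add: power2_eq_iff_nonneg)
  qed
  have U_ray: "\<exists>c. cmod c = 1 \<and> U x = c *\<^sub>C T x" for x
  proof (cases "cinner x e = 0")
    case True
    then have "\<kappa> (cinner x e) = 0" using \<kappa>_simps(3)[of 0] by simp
    then have "U x = V x" using True by (simp add: U_def P_def)
    then show ?thesis using V_ray[of x] True by (simp add: M_def)
  next
    case False
    let ?a = "cinner x e"
    define y where "y = (1 / ?a) *\<^sub>C P x"
    have y: "M y" unfolding y_def by (rule M_scale[OF MP MP])
    have "?a *\<^sub>C (e + y) = ?a *\<^sub>C e + P x"
      using False by (simp add: y_def scaleC_add_right scaleC_scaleC)
    also have "\<dots> = x" by (simp add: P_def)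
    finally have x: "x = ?a *\<^sub>C (e + y)" by (rule sym)
    have "P x = ?a *\<^sub>C y" using False by (simp add: y_def scaleC_scaleC)
    then have "U x = \<kappa> ?a *\<^sub>C (f + V y)" by (simp add: U_def V_scale[OF y] scaleC_add_right)
    then have "cmod (cinner (U x) (T x)) = cmod ?a * cmod (cinner (f + V y) (T x))"
      by (simp add: cinner_scaleC_left norm_mult \<kappa>_simps)
    also have "\<dots> = cmod ?a * cmod (cinner (T (e + y)) (T x))"
      by (simp add: TV[OF y] cinner_scaleC_left norm_mult ph[OF y])
    also have "\<dots> = cmod (cinner (?a *\<^sub>C (e + y)) x)"
      by (simp add: pres cinner_scaleC_left norm_mult)
    also have "\<dots> = (norm x)\<^sup>2" unfolding x[symmetric] by (simp add: cinner_self norm_power)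
    finally show ?thesis
      by (intro unit_multiple_if_cmod_cinner_eq) (simp_all add: U_norm normT)
  qed
  have U_surj: "surj U"
  proof (rule surjI)
    fix z
    let ?w = "SOME w. U w = z"
    obtain x c where xc: "z = c *\<^sub>C T x" using surj by blast
    obtain d where d: "cmod d = 1" "U x = d *\<^sub>C T x" using U_ray by blast
    have "U (\<kappa> (c / d) *\<^sub>C x) = z"
      using d by (auto simp: U_scale \<kappa>_simps scaleC_scaleC xc)
    then show "U ?w = z" by (rule someI)
  qed
  show thesis
  proof (rule that)
    show "unitary_op U \<or> antiunitary_op U"
      using \<kappa> U_add U_scale U_norm U_surj unfolding unitary_op_def antiunitary_op_def by auto
  qed (rule U_ray)
qed

section \<open>Symmetries of the effect algebra\<close>

lemma orthonormal_pair_if_dim_ge_2: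
  assumes "hilbert_dim TYPE('a::complex_hilbert) \<ge> 2"
  obtains e g :: "'a::complex_hilbert" where "norm e = 1" "norm g = 1" "cinner e g = 0"
proof -
  have big: "cspan B \<noteq> (UNIV :: 'a set)" if "finite B" "card B < 2" for B :: "'a set"
  proof
    assume B: "cspan B = (UNIV :: 'a set)"
    then have "cdim (UNIV :: 'a set) \<le> card B"
      using complex_vector.dim_le_card[of "UNIV :: 'a set" B] that(1) by simp
    then have "cdim (UNIV :: 'a set) < 2" using that(2) by simp
    moreover have "hilbert_dim TYPE('a) = enat (cdim (UNIV :: 'a set))"
      using B that(1) unfolding hilbert_dim_def by auto
    ultimately show False
      using assms by (simp add: numeral_eq_enat)
  qed
  obtain x :: 'a where "x \<notin> cspan {}" using big[of "{}"] by auto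
  then have x: "x \<noteq> 0" using complex_vector.span_zero by blast
  define e where "e = x /\<^sub>R norm x"
  have e: "norm e = 1" using x by (simp add: e_def)
  obtain y :: 'a where y: "y \<notin> cspan {e}" using big[of "{e}"] by auto
  define w where "w = y - cinner y e *\<^sub>C e"
  have "cinner y e *\<^sub>C e \<in> cspan {e}"
    by (intro complex_vector.span_scale complex_vector.span_base) simp
  then have w: "w \<noteq> 0" using y by (auto simp: w_def)
  have "cinner w e = 0" using e by (simp add: w_def cinner_expand cinner_unit)
  then have "cinner e w = 0" using cinner_commute[of e w] by simp
  then show thesis
    using that[of e "w /\<^sub>R norm w"] e w by (simp add: cinner_scaleR_right)
qed

lemma pair_with_overlap:
  assumes "norm e = 1" "norm g = 1" "cinner e (g::'a::complex_inner) = 0" "0 \<le> p" "p \<le> 1"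
  obtains y where "norm y = 1" "(cmod (cinner e y))\<^sup>2 = p"
proof -
  define y where "y = sqrt p *\<^sub>R e + sqrt (1 - p) *\<^sub>R g"
  have ge: "cinner g e = 0" using assms(3) cinner_commute[of g e] by simp
  have "cinner y y = complex_of_real (sqrt p * sqrt p + sqrt (1 - p) * sqrt (1 - p))"
    using assms(1,2,3) ge
    by (simp add: y_def cinner_expand cinner_unit del: real_sqrt_mult_self flip: of_real_mult)
  then have "(norm y)\<^sup>2 = sqrt p * sqrt p + sqrt (1 - p) * sqrt (1 - p)"
    by (simp only: cinner_self of_real_eq_iff)
  then have "(norm y)\<^sup>2 = 1" using assms(4,5) by simp
  then have "norm y = 1" using power2_eq_imp_eq[of "norm y" 1] by simp
  moreover have "(cmod (cinner e y))\<^sup>2 = p"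
    using assms by (simp add: y_def cinner_expand cinner_unit)
  ultimately show thesis by (rule that)
qed

text \<open>
  The orthonormal pair provides two rays of every prescribed overlap. In one dimension every
  increasing bijection of \<open>[0,1]\<close> would induce a symmetry.
\<close>

locale effect_symmetry =
  fixes \<phi> :: "('a::complex_hilbert \<Rightarrow>\<^sub>L 'a) \<Rightarrow> ('a \<Rightarrow>\<^sub>L 'a)" and e g :: 'a
  assumes bij: "bij_betw \<phi> effects effects"
    and order: "\<And>E F. E \<in> effects \<Longrightarrow> F \<in> effects \<Longrightarrow> \<phi> E \<preceq> \<phi> F \<longleftrightarrow> E \<preceq> F"
    and coex: "\<And>E F. E \<in> effects \<Longrightarrow> F \<in> effects \<Longrightarrow> coexistent (\<phi> E) (\<phi> F) \<longleftrightarrow> coexistent E F"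
    and e: "norm e = 1" and g: "norm g = 1" and eg: "cinner e g = 0"
begin

lemma image_effect: "E \<in> effects \<Longrightarrow> \<phi> E \<in> effects"
  using bij by (rule bij_betwE[THEN bspec])

lemma preimage_effect:
  assumes "E \<in> effects" obtains E' where "E' \<in> effects" "\<phi> E' = E"
  using bij assms unfolding bij_betw_def by (metis imageE)

lemma image_inj: "E \<in> effects \<Longrightarrow> F \<in> effects \<Longrightarrow> \<phi> E = \<phi> F \<longleftrightarrow> E = F"
  using bij unfolding bij_betw_def by (metis inj_onD)

lemma ball_image: "(\<forall>E\<in>effects. Q (\<phi> E)) \<longleftrightarrow> (\<forall>E\<in>effects. Q E)"
  using bij unfolding bij_betw_def by (metis imageE image_eqI)

lemma chain_effect_image:
  assumes "E \<in> effects" shows "chain_effect (\<phi> E) \<longleftrightarrow> chain_effect E"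
proof -
  have "chain_effect (\<phi> E) \<longleftrightarrow> (\<forall>A\<in>effects. \<forall>B\<in>effects.
      \<phi> A \<preceq> \<phi> E \<longrightarrow> \<phi> B \<preceq> \<phi> E \<longrightarrow> \<phi> A \<preceq> \<phi> B \<or> \<phi> B \<preceq> \<phi> A)"
    unfolding chain_effect_def
    by (subst ball_image[symmetric], subst ball_image[symmetric]) (simp add: image_effect assms)
  then show ?thesis using assms by (simp add: order chain_effect_def cong: ball_cong)
qed

lemma chain_effect_effect: "chain_effect E \<Longrightarrow> E \<in> effects"
  by (simp add: chain_effect_def)

text \<open>Maximality among chain effects is an order-theoretic notion, hence transported by \<open>\<phi>\<close>.\<close>

lemma rank_one_image_iff:
  assumes "E \<in> effects"
  shows "(\<exists>x. norm x = 1 \<and> \<phi> E = rank_one x) \<longleftrightarrow> (\<exists>x. norm x = 1 \<and> E = rank_one x)"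
proof -
  have "(\<forall>F. chain_effect F \<longrightarrow> \<phi> E \<preceq> F \<longrightarrow> F = \<phi> E) \<longleftrightarrow>
      (\<forall>F\<in>effects. chain_effect F \<longrightarrow> \<phi> E \<preceq> F \<longrightarrow> F = \<phi> E)"
    using chain_effect_effect by blast
  also have "\<dots> \<longleftrightarrow> (\<forall>F\<in>effects. chain_effect (\<phi> F) \<longrightarrow> \<phi> E \<preceq> \<phi> F \<longrightarrow> \<phi> F = \<phi> E)"
    by (subst ball_image[symmetric]) simp
  also have "\<dots> \<longleftrightarrow> (\<forall>F\<in>effects. chain_effect F \<longrightarrow> E \<preceq> F \<longrightarrow> F = E)"
    using assms by (simp add: order chain_effect_image image_inj cong: ball_cong)
  also have "\<dots> \<longleftrightarrow> (\<forall>F. chain_effect F \<longrightarrow> E \<preceq> F \<longrightarrow> F = E)"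
    using chain_effect_effect by blast
  finally show ?thesis
    unfolding maximal_chain_effect_iff[OF e, symmetric] chain_effect_image[OF assms] by simp
qed

text \<open>
  On unit vectors, a choice of representatives for the induced map on rays; the phases are
  arbitrary.
\<close>

definition ray_map :: "'a \<Rightarrow> 'a" where
  "ray_map x = (SOME y. norm y = 1 \<and> \<phi> (rank_one x) = rank_one y)"

lemma ray_map_spec:
  assumes "norm x = 1" shows "norm (ray_map x) = 1" "\<phi> (rank_one x) = rank_one (ray_map x)"
proof -
  have "\<exists>y. norm y = 1 \<and> \<phi> (rank_one x) = rank_one y"
    using rank_one_image_iff[OF rank_one_effect] assms by blast
  from someI_ex[OF this] show "norm (ray_map x) = 1" "\<phi> (rank_one x) = rank_one (ray_map x)"
    by (simp_all add: ray_map_def)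
qed

lemma ray_map_surj:
  assumes "norm y = 1"
  obtains x where "norm x = 1" "cmod (cinner y (ray_map x)) = 1"
proof -
  obtain E where E: "E \<in> effects" "\<phi> E = rank_one y" using preimage_effect[OF rank_one_effect[OF assms]] .
  then obtain x where x: "norm x = 1" "E = rank_one x" using rank_one_image_iff[OF E(1)] assms by blast
  then have "rank_one y = rank_one (ray_map x)" using E(2) ray_map_spec(2)[OF x(1)] by simp
  then show thesis using rank_one_eq_iff[OF assms ray_map_spec(1)[OF x(1)]] that x(1) by blast
qed

text \<open>
  Scalars are the effects that coexist with all others, a notion that \<open>\<phi>\<close> transports.
\<close>

lemma scalar_image_iff:
  assumes "E \<in> effects"
  shows "(\<exists>t. 0 \<le> t \<and> t \<le> 1 \<and> \<phi> E = t *\<^sub>R id_blinfun) \<longleftrightarrow> (\<exists>t. 0 \<le> t \<and> t \<le> 1 \<and> E = t *\<^sub>R id_blinfun)"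
proof -
  have "(\<forall>F\<in>effects. coexistent (\<phi> E) F) \<longleftrightarrow> (\<forall>F\<in>effects. coexistent (\<phi> E) (\<phi> F))"
    by (rule ball_image[symmetric])
  also have "\<dots> \<longleftrightarrow> (\<forall>F\<in>effects. coexistent E F)"
    using assms by (simp add: coex cong: ball_cong)
  finally show ?thesis
    unfolding scalar_iff_coexistent_with_all[OF assms e]
      scalar_iff_coexistent_with_all[OF image_effect[OF assms] e] .
qed

definition scalar_map :: "real \<Rightarrow> real" where
  "scalar_map t = (SOME s. 0 \<le> s \<and> s \<le> 1 \<and> \<phi> (t *\<^sub>R id_blinfun) = s *\<^sub>R id_blinfun)"

lemma scalar_map_spec:
  assumes "0 \<le> t" "t \<le> 1"
  shows "0 \<le> scalar_map t" "scalar_map t \<le> 1" "\<phi> (t *\<^sub>R id_blinfun) = scalar_map t *\<^sub>R id_blinfun"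
proof -
  have "\<exists>s. 0 \<le> s \<and> s \<le> 1 \<and> \<phi> (t *\<^sub>R id_blinfun) = s *\<^sub>R id_blinfun"
    using scalar_image_iff[OF scalar_effect] assms by blast
  from someI_ex[OF this] show "0 \<le> scalar_map t" "scalar_map t \<le> 1" "\<phi> (t *\<^sub>R id_blinfun) = scalar_map t *\<^sub>R id_blinfun"
    by (simp_all add: scalar_map_def)
qed

lemma scalar_map_le_iff:
  assumes "0 \<le> s" "s \<le> 1" "0 \<le> t" "t \<le> 1" shows "scalar_map s \<le> scalar_map t \<longleftrightarrow> s \<le> t"
  using order[OF scalar_effect scalar_effect, OF assms]
  by (simp only: scalar_map_spec(3) assms scalar_le_iff[OF e])

lemma scalar_map_surj:
  assumes "0 \<le> r" "r \<le> 1" obtains s where "0 \<le> s" "s \<le> 1" "scalar_map s = r"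
proof -
  obtain E where E: "E \<in> effects" "\<phi> E = r *\<^sub>R id_blinfun"
    using preimage_effect[OF scalar_effect[OF assms]] .
  then obtain s where s: "0 \<le> s" "s \<le> 1" "E = s *\<^sub>R id_blinfun"
    using scalar_image_iff[OF E(1)] assms by blast
  then have "scalar_map s *\<^sub>R id_blinfun = (r *\<^sub>R id_blinfun :: 'a \<Rightarrow>\<^sub>L 'a)" using E(2) scalar_map_spec(3) by simp
  then have "(scalar_map s *\<^sub>R id_blinfun) e = ((r *\<^sub>R id_blinfun) e :: 'a)" by (simp only:)
  then have "scalar_map s = r" using e by (auto simp: blinfun.scaleR_left)
  then show thesis using that s by blast
qed

lemma scalar_map_bij: "bij_betw scalar_map {0..1} {0..1}"
proof -
  have "inj_on scalar_map {0..1}"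
  proof (rule inj_onI)
    fix s t assume "s \<in> {0..1}" "t \<in> {0..1}" "scalar_map s = scalar_map t"
    then show "s = t" using scalar_map_le_iff[of s t] scalar_map_le_iff[of t s] by simp
  qed
  moreover have "scalar_map ` {0..1} = {0..1}"
  proof (intro subset_antisym subsetI)
    fix r assume "r \<in> scalar_map ` {0..1}"
    then show "r \<in> {0..1}" using scalar_map_spec by auto
  next
    fix r :: real assume "r \<in> {0..1}"
    then obtain s where "0 \<le> s" "s \<le> 1" "scalar_map s = r" using scalar_map_surj[of r] by auto
    then show "r \<in> scalar_map ` {0..1}" by force
  qed
  ultimately show ?thesis by (simp add: bij_betw_def)
qed

lemma scalar_map_open: "0 < t \<Longrightarrow> t < 1 \<Longrightarrow> 0 < scalar_map t \<and> scalar_map t < 1"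
proof -
  assume t: "0 < t" "t < 1"
  have "\<not> scalar_map t \<le> scalar_map 0" "\<not> scalar_map 1 \<le> scalar_map t" using scalar_map_le_iff[of t 0] scalar_map_le_iff[of 1 t] t by simp_all
  then show ?thesis using scalar_map_spec[of 0] scalar_map_spec[of 1] by linarith
qed

text \<open>
  A multiple of a projection is measured by the scalars above it, so it is rescaled by the same
  function \<open>scalar_map\<close> as the scalars, whatever the ray.
\<close>

lemma image_scaled:
  assumes x: "norm x = 1" and t: "0 \<le> t" "t \<le> 1"
  shows "\<phi> (t *\<^sub>R rank_one x) = scalar_map t *\<^sub>R rank_one (ray_map x)"
proof -
  have eff: "t *\<^sub>R rank_one x \<in> effects" using scaled_effect[OF x t] .
  have "t *\<^sub>R rank_one x \<preceq> 1 *\<^sub>R rank_one x" using scaled_le_iff[OF x] t by blast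
  then have "\<phi> (t *\<^sub>R rank_one x) \<preceq> 1 *\<^sub>R rank_one (ray_map x)"
    using order[OF eff rank_one_effect[OF x]] ray_map_spec(2)[OF x] by simp
  from below_rank_one[OF image_effect[OF eff] this ray_map_spec(1)[OF x]]
  obtain r where r: "0 \<le> r" "r \<le> 1" "\<phi> (t *\<^sub>R rank_one x) = r *\<^sub>R rank_one (ray_map x)" .
  have cmp: "r \<le> scalar_map s \<longleftrightarrow> t \<le> s" if "0 \<le> s" "s \<le> 1" for s
    using order[OF eff scalar_effect[OF that]] unfolding r(3) scalar_map_spec(3)[OF that]
      scaled_le_scalar_iff[OF ray_map_spec(1)[OF x] r(1)] scaled_le_scalar_iff[OF x t(1)] .
  obtain s where s: "0 \<le> s" "s \<le> 1" "scalar_map s = r" using scalar_map_surj[OF r(1,2)] .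
  have "r \<le> scalar_map t" using cmp[OF t] by simp
  moreover have "scalar_map t \<le> r" using cmp[OF s(1,2)] s scalar_map_le_iff[OF t s(1,2)] by simp
  ultimately show ?thesis using r(3) by simp
qed

text \<open>\<open>two_level s (1 - s) y\<close> is the supremum of \<open>s I\<close> and a projection, which \<open>\<phi>\<close> respects.\<close>

lemma image_two_level:
  assumes y: "norm y = 1" and s: "0 \<le> s" "s \<le> 1"
  shows "\<phi> (two_level s (1 - s) y) = two_level (scalar_map s) (1 - scalar_map s) (ray_map y)"
proof -
  let ?E = "two_level s (1 - s) y" and ?F = "two_level (scalar_map s) (1 - scalar_map s) (ray_map y)"
  have E: "?E \<in> effects" using two_level_effect[OF y] s by simp
  have F: "?F \<in> effects" using two_level_effect[OF ray_map_spec(1)[OF y]] scalar_map_spec[OF s] by simp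
  have S: "s *\<^sub>R id_blinfun \<in> (effects :: ('a \<Rightarrow>\<^sub>L 'a) set)" using scalar_effect[OF s] .
  have R: "rank_one y \<in> effects" using rank_one_effect[OF y] .
  obtain G where G: "G \<in> effects" "\<phi> G = ?F" using preimage_effect[OF F] .
  have "scalar_map s *\<^sub>R id_blinfun \<preceq> \<phi> ?E"
    using order[OF S E] scalar_le_two_level[OF s(2)] scalar_map_spec(3)[OF s] by simp
  moreover have "rank_one (ray_map y) \<preceq> \<phi> ?E"
    using order[OF R E] rank_one_le_two_level[OF y s(1)] ray_map_spec(2)[OF y] by simp
  ultimately have le: "?F \<preceq> \<phi> ?E" by (rule two_level_le_if_upper_bound[OF image_effect[OF E] ray_map_spec(1)[OF y]])
  have "s *\<^sub>R id_blinfun \<preceq> G"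
    using order[OF S G(1)] scalar_le_two_level[OF scalar_map_spec(2)[OF s], of "ray_map y"] scalar_map_spec(3)[OF s] G(2) by simp
  moreover have "rank_one y \<preceq> G"
    using order[OF R G(1)] rank_one_le_two_level[OF ray_map_spec(1)[OF y] scalar_map_spec(1)[OF s]] ray_map_spec(2)[OF y] G(2) by simp
  ultimately have "?E \<preceq> G" by (rule two_level_le_if_upper_bound[OF G(1) y])
  then have "\<phi> ?E \<preceq> ?F" using order[OF E G(1)] G(2) by simp
  then show ?thesis
    using op_le_antisym[OF effects_hermitian effects_hermitian] image_effect[OF E] F le by blast
qed

lemma overlap_le_1:
  assumes "norm x = 1" "norm y = 1" shows "(cmod (cinner x (y::'a)))\<^sup>2 \<le> 1"
  using cmod_cinner_le_unit[OF assms(2), of x] assms(1) power2_norm_eq_inner[of x] by simp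

text \<open>
  \<open>order_invariance\<close> and \<open>coexistence_invariance\<close> express that \<open>\<phi>\<close> respects the order and
  coexistence by means of overlaps and scalars only. Order invariance alone is compatible with every
  rescaling \<open>s / (s + c (1 - s))\<close> of the scalars and unchanged overlaps; coexistence excludes
  \<open>c \<noteq> 1\<close>.
\<close>

lemma order_invariance:
  assumes x: "norm x = 1" and y: "norm y = 1" and s: "0 < s" "s < 1" and t: "0 \<le> t" "t \<le> 1"
  shows "t * ((1 - (cmod (cinner x y))\<^sup>2) / s + (cmod (cinner x y))\<^sup>2) \<le> 1 \<longleftrightarrow>
    scalar_map t * ((1 - (cmod (cinner (ray_map x) (ray_map y)))\<^sup>2) / scalar_map s + (cmod (cinner (ray_map x) (ray_map y)))\<^sup>2) \<le> 1"
proof -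
  have s': "0 \<le> s" "s \<le> 1" using s by simp_all
  have fs: "0 < scalar_map s" using scalar_map_open[OF s] by simp
  have "two_level s (1 - s) y \<in> effects" using two_level_effect[OF y] s by simp
  from order[OF scaled_effect[OF x t] this]
  have "scalar_map t *\<^sub>R rank_one (ray_map x) \<preceq> two_level (scalar_map s) (1 - scalar_map s) (ray_map y) \<longleftrightarrow>
      t *\<^sub>R rank_one x \<preceq> two_level s (1 - s) y"
    unfolding image_scaled[OF x t] image_two_level[OF y s'] .
  then show ?thesis
    using scaled_le_two_level_iff[OF x y s(1) _ t(1), of "1 - s"]
      scaled_le_two_level_iff[OF ray_map_spec(1)[OF x] ray_map_spec(1)[OF y] fs _ scalar_map_spec(1)[OF t], of "1 - scalar_map s"]
    by simp
qed

lemma coexistence_invariance: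
  assumes x: "norm x = 1" and y: "norm y = 1" and xy: "cmod (cinner x y) \<noteq> 1"
    and s: "0 < s" "s < 1" and t: "0 < t" "t < 1"
  shows "t * s * (cmod (cinner x y))\<^sup>2 \<le> (1 - t) * (1 - s) \<longleftrightarrow>
    scalar_map t * scalar_map s * (cmod (cinner (ray_map x) (ray_map y)))\<^sup>2 \<le> (1 - scalar_map t) * (1 - scalar_map s)"
proof -
  have s': "0 \<le> s" "s \<le> 1" and t': "0 \<le> t" "t \<le> 1" using s t by simp_all
  have "rank_one x \<noteq> rank_one y" using rank_one_eq_iff[OF x y] xy by simp
  then have "rank_one (ray_map x) \<noteq> rank_one (ray_map y)"
    using image_inj[OF rank_one_effect[OF x] rank_one_effect[OF y]] ray_map_spec(2)[OF x] ray_map_spec(2)[OF y] by simp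
  then have "cmod (cinner (ray_map x) (ray_map y)) \<noteq> 1" using rank_one_eq_iff[OF ray_map_spec(1)[OF x] ray_map_spec(1)[OF y]] by simp
  then show ?thesis
    using coex[OF scaled_effect[OF x t'] scaled_effect[OF y s']]
      coexistent_scaled_iff[OF x y xy t s]
      coexistent_scaled_iff[OF ray_map_spec(1)[OF x] ray_map_spec(1)[OF y], of "scalar_map t" "scalar_map s"] scalar_map_open[OF s] scalar_map_open[OF t]
    unfolding image_scaled[OF x t'] image_scaled[OF y s'] by simp
qed

lemma scalar_map_id: "0 \<le> t \<Longrightarrow> t \<le> 1 \<Longrightarrow> scalar_map t = t"
proof (rule unit_interval_rigidity[OF scalar_map_bij])
  show "scalar_map s \<le> scalar_map t \<longleftrightarrow> s \<le> t" if "s \<in> {0..1}" "t \<in> {0..1}" for s t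
    using scalar_map_le_iff that by simp
  fix p :: real assume p: "0 < p" "p < 1"
  obtain y where y: "norm y = 1" "(cmod (cinner e y))\<^sup>2 = p"
    using pair_with_overlap[OF e g eg, of p] p by auto
  let ?q = "(cmod (cinner (ray_map e) (ray_map y)))\<^sup>2"
  have ne: "cmod (cinner e y) \<noteq> 1" using y(2) p by auto
  have "rank_one e \<noteq> rank_one y" using rank_one_eq_iff[OF e y(1)] ne by simp
  then have "rank_one (ray_map e) \<noteq> rank_one (ray_map y)"
    using image_inj[OF rank_one_effect[OF e] rank_one_effect[OF y(1)]] ray_map_spec(2)[OF e] ray_map_spec(2)[OF y(1)] by simp
  then have "cmod (cinner (ray_map e) (ray_map y)) \<noteq> 1"
    using rank_one_eq_iff[OF ray_map_spec(1)[OF e] ray_map_spec(1)[OF y(1)]] by simp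
  then have "?q \<noteq> 1" using power2_eq_imp_eq[of "cmod (cinner (ray_map e) (ray_map y))" 1] by auto
  then have "?q < 1" using overlap_le_1[OF ray_map_spec(1)[OF e] ray_map_spec(1)[OF y(1)]] by simp
  then show "\<exists>p'<1.
      (\<forall>s\<in>{0<..<1}. \<forall>t\<in>{0<..<1}. t * ((1 - p) / s + p) \<le> 1 \<longleftrightarrow> scalar_map t * ((1 - p') / scalar_map s + p') \<le> 1) \<and>
      (\<forall>s\<in>{0<..<1}. \<forall>t\<in>{0<..<1}. t * s * p \<le> (1 - t) * (1 - s) \<longleftrightarrow> scalar_map t * scalar_map s * p' \<le> (1 - scalar_map t) * (1 - scalar_map s))"
    using order_invariance[OF e y(1)] coexistence_invariance[OF e y(1) ne]
    unfolding y(2) by (intro exI[of _ ?q] conjI ballI) simp_all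
qed simp

text \<open>With trivial rescaling, the strength of \<open>two_level (1/2) (1/2) y\<close> along \<open>x\<close> determines the overlap.\<close>

lemma ray_map_overlap:
  assumes x: "norm x = 1" and y: "norm y = 1"
  shows "cmod (cinner (ray_map x) (ray_map y)) = cmod (cinner x y)"
proof -
  let ?p = "(cmod (cinner x y))\<^sup>2" and ?q = "(cmod (cinner (ray_map x) (ray_map y)))\<^sup>2"
  have p: "0 \<le> ?p" "?p \<le> 1" and q: "0 \<le> ?q" "?q \<le> 1"
    using overlap_le_1[OF x y] overlap_le_1[OF ray_map_spec(1)[OF x] ray_map_spec(1)[OF y]] by simp_all
  have inv: "t * (2 - ?p) \<le> 1 \<longleftrightarrow> t * (2 - ?q) \<le> 1" if "0 \<le> t" "t \<le> 1" for t
    using order_invariance[OF x y, of "1/2" t] that scalar_map_id[of t] scalar_map_id[of "1/2"] by (simp add: algebra_simps)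
  have "?p \<le> ?q" using inv[of "1 / (2 - ?p)"] p q by (simp add: field_simps)
  moreover have "?q \<le> ?p" using inv[of "1 / (2 - ?q)"] p q by (simp add: field_simps)
  ultimately have "?q = ?p" by simp
  then show ?thesis by (simp add: power2_eq_iff_nonneg)
qed

lemma ray_map_implemented:
  obtains U where "unitary_op U \<or> antiunitary_op U" "\<And>x. norm x = 1 \<Longrightarrow> rank_one (U x) = rank_one (ray_map x)"
proof -
  define S where "S x = norm x *\<^sub>R ray_map (x /\<^sub>R norm x)" for x
  have S: "cmod (cinner (S x) (S y)) = cmod (cinner x y)" for x y
  proof (cases "x = 0 \<or> y = 0")
    case True
    then show ?thesis by (auto simp: S_def)
  next
    case False
    then have "cmod (cinner (S x) (S y)) = norm x * norm y * cmod (cinner (x /\<^sub>R norm x) (y /\<^sub>R norm y))"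
      by (simp add: S_def cinner_scaleR_left[of _ "ray_map (x /\<^sub>R norm x)"]
          cinner_scaleR_right[of "ray_map (x /\<^sub>R norm x)"] norm_mult ray_map_overlap)
    also have "\<dots> = cmod (cinner x y)"
      using False by (simp add: cinner_scaleR_left cinner_scaleR_right norm_mult norm_divide field_simps)
    finally show ?thesis .
  qed
  have S_unit: "S x = ray_map x" if "norm x = 1" for x using that by (simp add: S_def)
  have surj: "\<exists>x c. z = c *\<^sub>C S x" for z
  proof (cases "z = 0")
    case True
    then show ?thesis by (intro exI[of _ 0]) simp
  next
    case False
    define y where "y = z /\<^sub>R norm z"
    have y: "norm y = 1" using False by (simp add: y_def)
    obtain x where x: "norm x = 1" "cmod (cinner y (ray_map x)) = 1" using ray_map_surj[OF y] .
    have "y = cinner y (ray_map x) *\<^sub>C ray_map x"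
      by (rule parallel_if_cmod_cinner_eq[OF ray_map_spec(1)[OF x(1)]]) (simp add: x y)
    then have "norm z *\<^sub>R y = norm z *\<^sub>R cinner y (ray_map x) *\<^sub>C S x" using S_unit[OF x(1)] by simp
    then have "z = (of_real (norm z) * cinner y (ray_map x)) *\<^sub>C S x"
      using False by (simp add: y_def scaleC_of_real[symmetric] scaleC_scaleC)
    then show ?thesis by blast
  qed
  obtain U where U: "unitary_op U \<or> antiunitary_op U" "\<And>x. \<exists>c. cmod c = 1 \<and> U x = c *\<^sub>C S x"
    using wigner[of S, OF S surj e] by blast
  have "rank_one (U x) = rank_one (ray_map x)" if x: "norm x = 1" for x
  proof -
    obtain c where c: "cmod c = 1" "U x = c *\<^sub>C ray_map x" using U(2)[of x] S_unit[OF x] by auto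
    have "norm (U x) = 1" using c ray_map_spec(1)[OF x] by simp
    moreover have "cmod (cinner (U x) (ray_map x)) = 1"
      using c ray_map_spec(1)[OF x] by (simp add: cinner_scaleC_left cinner_unit)
    ultimately show ?thesis using rank_one_eq_iff ray_map_spec(1)[OF x] by blast
  qed
  then show thesis using U(1) that by blast
qed

end

text \<open>
  Here \<open>\<kappa>\<close> is the identity or complex conjugation, so that both kinds of operator can be treated
  at once.
\<close>

lemma unitary_or_antiunitaryE:
  assumes "unitary_op U \<or> antiunitary_op (U :: 'a::complex_hilbert \<Rightarrow> 'a)"
  obtains \<kappa> where "\<And>x y. U (x + y) = U x + U y" "\<And>c x. U (c *\<^sub>C x) = \<kappa> c *\<^sub>C U x"
    "\<And>x y. cinner (U x) (U y) = \<kappa> (cinner x y)" "\<And>x. norm (U x) = norm x" "bij U"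
    "\<And>c. \<kappa> (\<kappa> c) = c" "\<And>r. \<kappa> (of_real r) = of_real r" "\<And>c. Re (\<kappa> c) = Re c"
    "\<And>c. cmod (\<kappa> c) = cmod c"
proof -
  have add: "\<And>x y. U (x + y) = U x + U y" and norm: "\<And>x. norm (U x) = norm x" and surj: "surj U"
    using assms unfolding unitary_op_def antiunitary_op_def by auto
  obtain \<kappa> where \<kappa>: "\<kappa> = (\<lambda>c. c) \<or> \<kappa> = cnj" and scale: "\<And>c x. U (c *\<^sub>C x) = \<kappa> c *\<^sub>C U x"
    using assms that unfolding unitary_op_def antiunitary_op_def by metis
  have real: "U (r *\<^sub>R x) = r *\<^sub>R U x" for r x
    using scale[of "of_real r" x] \<kappa> by (auto simp: scaleC_of_real)
  have diff: "U (x - y) = U x - U y" for x y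
    using add[of x "(-1) *\<^sub>R y"] real[of "-1" y] by simp
  have inner: "inner (U x) (U y) = inner x y" for x y
    unfolding dot_norm by (simp add: add[symmetric] norm)
  have cinner: "cinner (U x) (U y) = \<kappa> (cinner x y)" for x y
  proof -
    have \<kappa>i: "\<i> *\<^sub>C U x = U (\<kappa> \<i> *\<^sub>C x)" using \<kappa> by (auto simp: scale)
    have "inner (\<i> *\<^sub>C U x) (U y) = inner (\<kappa> \<i> *\<^sub>C x) y" by (simp only: \<kappa>i inner)
    then have "Im (cinner (U x) (U y)) = - inner (\<kappa> \<i> *\<^sub>C x) y" by (simp add: Im_cinner_eq)
    also have "\<dots> = Im (\<kappa> (cinner x y))"
      using \<kappa> by (auto simp: inner_eq_Re_cinner cinner_scaleC_left)
    finally have "Im (cinner (U x) (U y)) = Im (\<kappa> (cinner x y))" .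
    moreover have "Re (cinner (U x) (U y)) = Re (\<kappa> (cinner x y))"
      using inner[of x y] \<kappa> by (auto simp: inner_eq_Re_cinner)
    ultimately show ?thesis by (simp add: complex_eq_iff)
  qed
  have "inj U"
  proof (rule injI)
    fix x y assume "U x = U y"
    then have "norm (x - y) = 0" using diff[of x y] norm[of "x - y"] by simp
    then show "x = y" by simp
  qed
  then have "bij U" using surj by (simp add: bij_def)
  then show thesis using that[OF add scale cinner norm] \<kappa> by auto
qed

text \<open>
  Conjugation with \<open>U\<close> is an operation on effects that moves the rank-one operators below an
  effect along \<open>U\<close>; by \<open>effects_eq_if_same_rank_ones\<close> this characterises the result.
\<close>

lemma conjugated_effect:
  assumes U: "unitary_op U \<or> antiunitary_op (U :: 'a::complex_hilbert \<Rightarrow> 'a)" and E: "E \<in> effects"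
  obtains G where "G \<in> effects" "blinfun_apply G = U \<circ> blinfun_apply E \<circ> inv U"
    "\<And>t x. 0 \<le> t \<Longrightarrow> t *\<^sub>R rank_one (U x) \<preceq> G \<longleftrightarrow> t *\<^sub>R rank_one x \<preceq> E"
proof -
  obtain \<kappa> where add: "\<And>x y. U (x + y) = U x + U y" and scale: "\<And>c x. U (c *\<^sub>C x) = \<kappa> c *\<^sub>C U x"
    and cinner: "\<And>x y. cinner (U x) (U y) = \<kappa> (cinner x y)" and norm: "\<And>x. norm (U x) = norm x"
    and bij: "bij U" and \<kappa>: "\<And>c. \<kappa> (\<kappa> c) = c" "\<And>r. \<kappa> (of_real r) = of_real r" "\<And>c. Re (\<kappa> c) = Re c"
      "\<And>c. cmod (\<kappa> c) = cmod c"
    using unitary_or_antiunitaryE[OF U] by blast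
  have herm: "hermitian E" using E by (rule effects_hermitian)
  define W where "W = inv U"
  have UW: "U (W x) = x" and WU: "W (U x) = x" for x
    using bij by (simp_all add: W_def bij_is_inj bij_is_surj surj_f_inv_f)
  have U_eqI: "x = y" if "U x = U y" for x y using that bij by (auto simp: bij_def inj_def)
  have W_add: "W (x + y) = W x + W y" for x y by (rule U_eqI) (simp add: add UW)
  have W_scale: "W (c *\<^sub>C x) = \<kappa> c *\<^sub>C W x" for c x by (rule U_eqI) (simp add: scale UW \<kappa>)
  have W_norm: "norm (W x) = norm x" for x using norm[of "W x"] UW by simp
  have real: "U (r *\<^sub>R x) = r *\<^sub>R U x" "W (r *\<^sub>R x) = r *\<^sub>R W x" for r x
    using scale[of "of_real r" x] W_scale[of "of_real r" x] by (simp_all add: \<kappa> scaleC_of_real)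
  have "bounded_linear (\<lambda>x. U (E (W x)))"
    by (rule bounded_linear_intro[of _ "norm E"])
      (simp_all add: W_add add real norm blinfun.add_right blinfun.scaleR_right,
        metis W_norm norm_blinfun mult.commute)
  then have G: "blinfun_apply (Blinfun (\<lambda>x. U (E (W x)))) = (\<lambda>x. U (E (W x)))"
    by (rule bounded_linear_Blinfun_apply)
  define G where "G = Blinfun (\<lambda>x. U (E (W x)))"
  have G: "G x = U (E (W x))" for x by (simp add: G_def G)
  have G_herm: "hermitian G"
    unfolding hermitian_def clinear_op_def selfadjoint_op_def
  proof (intro conjI allI)
    show "G (c *\<^sub>C x) = c *\<^sub>C G x" for c x
      by (simp add: G W_scale hermitian_scaleC[OF herm] scale \<kappa>)
    show "cinner (G x) y = cinner x (G y)" for x y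
    proof -
      have "cinner (U (E (W x))) (U (W y)) = cinner (U (W x)) (U (E (W y)))"
        unfolding cinner hermitian_cinner[OF herm] ..
      then show ?thesis by (simp only: G UW)
    qed
  qed
  have inner_U: "inner (U x) (U y) = inner x y" for x y by (simp add: inner_eq_Re_cinner cinner \<kappa>)
  have q: "inner (G (U x)) (U x) = inner (E x) x" for x by (simp only: G WU inner_U)
  have surj: "(\<forall>y. Q y) \<longleftrightarrow> (\<forall>x. Q (U x))" for Q by (metis UW)
  have "G \<in> effects"
    using E G_herm unfolding effects_iff by (subst surj) (simp add: q inner_U)
  moreover have "blinfun_apply G = U \<circ> blinfun_apply E \<circ> inv U" by (rule ext) (simp add: G W_def)
  moreover have "t *\<^sub>R rank_one (U x) \<preceq> G \<longleftrightarrow> t *\<^sub>R rank_one x \<preceq> E" if "0 \<le> t" for t x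
    unfolding op_le_iff[OF hermitian_scaled G_herm] op_le_iff[OF hermitian_scaled herm] inner_scaled
    by (subst surj) (simp add: q cinner \<kappa>)
  ultimately show thesis by (rule that)
qed

theorem theorem1:
  fixes \<phi> :: "('a::complex_hilbert \<Rightarrow>\<^sub>L 'a) \<Rightarrow> ('a \<Rightarrow>\<^sub>L 'a)"
  assumes dim: "hilbert_dim TYPE('a) \<ge> 3"
    and bij: "bij_betw \<phi> effects effects"
    and order: "\<forall>E\<in>effects. \<forall>F\<in>effects. E \<preceq> F \<longleftrightarrow> \<phi> E \<preceq> \<phi> F"
    and coex: "\<forall>E\<in>effects. \<forall>F\<in>effects. coexistent E F \<longleftrightarrow> coexistent (\<phi> E) (\<phi> F)"
  shows "\<exists>U :: 'a \<Rightarrow> 'a. (unitary_op U \<or> antiunitary_op U) \<and>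
    (\<forall>E\<in>effects. blinfun_apply (\<phi> E) = U \<circ> blinfun_apply E \<circ> inv U)"
proof -
  have "hilbert_dim TYPE('a) \<ge> 2"
    using order_trans[OF _ dim, of 2] by (simp add: numeral_eq_enat)
  then obtain e g :: 'a where eg: "norm e = 1" "norm g = 1" "cinner e g = 0"
    by (rule orthonormal_pair_if_dim_ge_2)
  interpret effect_symmetry \<phi> e g
    by unfold_locales (use assms eg in blast)+
  obtain U where U: "unitary_op U \<or> antiunitary_op U"
    "\<And>x. norm x = 1 \<Longrightarrow> rank_one (U x) = rank_one (ray_map x)"
    using ray_map_implemented by blast
  have norm: "norm (U x) = norm x" for x
    using U(1) unfolding unitary_op_def antiunitary_op_def by blast
  have surj: "\<exists>x. U x = z" for z
    using U(1) unfolding unitary_op_def antiunitary_op_def by (metis surjD)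
  have "blinfun_apply (\<phi> E) = U \<circ> blinfun_apply E \<circ> inv U" if E: "E \<in> effects" for E
  proof -
    obtain G where G: "G \<in> effects" "blinfun_apply G = U \<circ> blinfun_apply E \<circ> inv U"
      "\<And>t x. 0 \<le> t \<Longrightarrow> t *\<^sub>R rank_one (U x) \<preceq> G \<longleftrightarrow> t *\<^sub>R rank_one x \<preceq> E"
      using conjugated_effect[OF U(1) E] by blast
    have "\<phi> E = G"
    proof (rule effects_eq_if_same_rank_ones[OF image_effect[OF E] G(1)])
      fix t :: real and z :: 'a assume z: "norm z = 1" and t: "0 \<le> t" "t \<le> 1"
      obtain x where x: "U x = z" using surj by blast
      then have nx: "norm x = 1" using norm[of x] z by simp
      have "t *\<^sub>R rank_one z = \<phi> (t *\<^sub>R rank_one x)"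
        using image_scaled[OF nx t] scalar_map_id[OF t] U(2)[OF nx] x by simp
      then have "t *\<^sub>R rank_one z \<preceq> \<phi> E \<longleftrightarrow> t *\<^sub>R rank_one x \<preceq> E"
        using order[OF scaled_effect[OF nx t] E] by simp
      then show "t *\<^sub>R rank_one z \<preceq> \<phi> E \<longleftrightarrow> t *\<^sub>R rank_one z \<preceq> G"
        using G(3)[OF t(1), of x] x by simp
    qed
    then show ?thesis using G(2) by simp
  qed
  then show ?thesis using U(1) by blast
qed

end
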